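(* Let $A\in M_n^h(\mathbb{C})$ and $x\in\mathbb{R}^n$. The following conditions are equivalent: a) $x=\mathrm{Diag}(A)$ is a solution of the problem $$\min_{w\in\mathbb{R},\ x\in\mathbb{R}^n}w\ \text{ such that }\ -w\le\lambda_i(A(x))\le w,\ 1\le i\le n$$ (i.e. $A=A(x)$ is minimal: $\|A\|\le\|A(y)\|$ for every $y\in\mathbb{R}^n$). b) If $\{q_1,\dots,q_n\}$ is an orthonormal basis of eigenvectors of $A$ corresponding to the eigenvalues $\|A\|=\lambda_1\ge\dots\ge\lambda_n=-\|A\|$, and $Q_1=[q_1|\dots|q_t]$, $Q_2=[q_{n-s+1}|\dots|q_n]$ are the $n\times t$ and $n\times s$ matrices whose columns correspond to the eigenvectors of $\lambda_1$ and $\lambda_n$ respectively, then there exist positive semidefinite self-adjoint matrices $U\in\mathbb{C}^{t\times t}$ and $V\in\mathbb{C}^{s\times s}$ such that $$\mathrm{tr}(U)+\mathrm{tr}(V)=1\quad\text{and}\quad\mathrm{tr}(Q_1^*E_kQ_1U)-\mathrm{tr}(Q_2^*E_kQ_2V)=0,\ \ \forall k=1,\dots,n.$$ c) There exists $X\in M_n(\mathbb{C})$ with $\mathrm{Diag}(X)=0$ such that $AX=\|A\|\,|X|$, where $|X|=(X^*X)^{1/2}$. d) Let $E_+$ (respectively $E_-$) be the spectral projection of $A$ corresponding to the eigenvalue $\lambda_1=\lambda_{\max}(A)$ (respectively $\lambda_n=\lambda_{\min}(A)$). Then there is a non-zero $X\in M_n^h(\mathbb{C})$ such that $$\mathrm{Diag}(X)=0,\quad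 E_+X^+=X^+,\quad E_-X^-=X^-\quad\text{and}\quad\mathrm{tr}(AX)=\|A\|\,\|X\|_1,$$ where $X^+=\frac{|X|+X}2$ and $X^-=\frac{|X|-X}2$ (with $|X|=(X^2)^{1/2}\ge0$).
   Context: $M_n(\mathbb{C})$ is the set of $n\times n$ complex matrices and $M_n^h(\mathbb{C})$ the Hermitian ones; $\|\cdot\|$ is the spectral norm and $\|X\|_1=\mathrm{tr}|X|$ the trace norm. $\mathrm{Diag}(y)$ for a vector $y$ is the diagonal matrix with diagonal $y$; $\mathrm{Diag}(X)$ for a matrix $X$ is its main diagonal. $A(y)=A_0+\mathrm{Diag}(y)$ for $y\in\mathbb{R}^n$, where $A_0\in M_n^h(\mathbb{C})$ is the matrix $A$ with its diagonal replaced by zeros, so that $A=A(x)$ for $x=\mathrm{Diag}(A)$. $\lambda_1(M)\ge\dots\ge\lambda_n(M)$ are the eigenvalues of a Hermitian $M$ counted with multiplicity; $t$ and $s$ are the multiplicities of $\lambda_1$ and $\lambda_n$. $E_k=e_ke_k^*$, with $\{e_k\}_{k=1}^n$ the canonical basis.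
   Formalization: In c) X is required to be non-zero (X=0 always works); the case n=1, A=0 is excluded (d fails there while a, b hold); in b) the equalities λ_1=‖A‖ and λ_n=-‖A‖ are asserted rather than only presupposed; x=Diag(A) is assumed throughout. *)

theory Defs
  imports "Jordan_Normal_Form.Schur_Decomposition" "Jordan_Normal_Form.Spectral_Radius"
begin

definition mat_trace :: "complex mat \<Rightarrow> complex" where
  "mat_trace M = (\<Sum>i<dim_row M. M $$ (i, i))"

definition vec_norm2 :: "complex vec \<Rightarrow> real" where
  "vec_norm2 v = sqrt (Re (v \<bullet>c v))"

text \<open>For a matrix with no columns the set below is empty and the value is unspecified.\<close>

definition spectral_norm :: "complex mat \<Rightarrow> real" where
  "spectral_norm M = Sup {vec_norm2 (M *\<^sub>v v) | v. v \<in> carrier_vec (dim_col M) \<and> vec_norm2 v = 1}"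

definition hermitian_mat :: "nat \<Rightarrow> complex mat \<Rightarrow> bool" where
  "hermitian_mat n M \<longleftrightarrow> M \<in> carrier_mat n n \<and> mat_adjoint M = M"

definition psd_mat :: "nat \<Rightarrow> complex mat \<Rightarrow> bool" where
  "psd_mat n M \<longleftrightarrow> hermitian_mat n M \<and> (\<forall>v\<in>carrier_vec n. 0 \<le> Re ((M *\<^sub>v v) \<bullet>c v))"

text \<open>The absolute value of a square matrix: the unique positive semidefinite square root
  of \<open>X\<^sup>* X\<close>.\<close>

definition mat_abs :: "complex mat \<Rightarrow> complex mat" where
  "mat_abs X = (THE P. psd_mat (dim_col X) P \<and> P * P = mat_adjoint X * X)"

definition trace_norm :: "complex mat \<Rightarrow> real" where
  "trace_norm X = Re (mat_trace (mat_abs X))"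

text \<open>Positive and negative parts, meant for Hermitian \<open>X\<close>, where \<open>X\<^sup>* X = X\<^sup>2\<close>.\<close>

definition pos_part :: "complex mat \<Rightarrow> complex mat" where
  "pos_part X = (1 / 2) \<cdot>\<^sub>m (mat_abs X + X)"

definition neg_part :: "complex mat \<Rightarrow> complex mat" where
  "neg_part X = (1 / 2) \<cdot>\<^sub>m (mat_abs X - X)"

text \<open>The eigenvalues of a Hermitian matrix in decreasing order, repeated according to
  multiplicity. They are real, so \<open>Re\<close> only changes the type. Indices start at 0:
  \<open>eig M i\<close> is the eigenvalue usually written with index \<open>i + 1\<close>.\<close>

definition eig :: "complex mat \<Rightarrow> nat \<Rightarrow> real" where
  "eig M i = rev (sorted_list_of_multiset (image_mset Re (proots (char_poly M)))) ! i"

definition eig_mult :: "complex mat \<Rightarrow> real \<Rightarrow> nat" where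
  "eig_mult M a = order (complex_of_real a) (char_poly M)"

text \<open>The spectral projection of a Hermitian matrix for \<open>a\<close>: the orthogonal projection whose
  range, i.e. whose set of fixed vectors, is the eigenspace of \<open>a\<close>.\<close>

definition spectral_proj :: "complex mat \<Rightarrow> real \<Rightarrow> complex mat" where
  "spectral_proj M a = (THE P. hermitian_mat (dim_row M) P \<and> P * P = P \<and>
     (\<forall>v\<in>carrier_vec (dim_row M). P *\<^sub>v v = v \<longleftrightarrow> M *\<^sub>v v = complex_of_real a \<cdot>\<^sub>v v))"

definition diag_vec :: "complex mat \<Rightarrow> complex vec" where
  "diag_vec M = vec (dim_row M) (\<lambda>i. M $$ (i, i))"

definition offdiag :: "complex mat \<Rightarrow> complex mat" where
  "offdiag M = mat (dim_row M) (dim_col M) (\<lambda>(i, j). if i = j then 0 else M $$ (i, j))"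

text \<open>The matrix \<open>A(y)\<close>: the diagonal of \<open>A\<close> is replaced by \<open>y\<close>.\<close>

definition with_diag :: "complex mat \<Rightarrow> real vec \<Rightarrow> complex mat" where
  "with_diag A y = offdiag A + mat_diag (dim_vec y) (\<lambda>i. complex_of_real (y $ i))"

definition feasible :: "nat \<Rightarrow> complex mat \<Rightarrow> real \<Rightarrow> real vec \<Rightarrow> bool" where
  "feasible n A w y \<longleftrightarrow> y \<in> carrier_vec n \<and>
     (\<forall>i<n. - w \<le> eig (with_diag A y) i \<and> eig (with_diag A y) i \<le> w)"

definition solves_min_problem :: "nat \<Rightarrow> complex mat \<Rightarrow> real vec \<Rightarrow> bool" where
  "solves_min_problem n A x \<longleftrightarrow>
     (\<exists>w. feasible n A w x \<and> (\<forall>w' y. feasible n A w' y \<longrightarrow> w \<le> w'))"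

text \<open>The rank-one matrix \<open>e\<^sub>k e\<^sub>k\<^sup>*\<close>.\<close>

definition unit_proj :: "nat \<Rightarrow> nat \<Rightarrow> complex mat" where
  "unit_proj n k = mat_of_cols n [unit_vec n k] * mat_adjoint (mat_of_cols n [unit_vec n k])"

text \<open>Being \<open>n\<close> orthonormal vectors of an \<open>n\<close>-dimensional space, the \<open>q ! i\<close> form a basis.\<close>

definition ordered_eigenbasis :: "nat \<Rightarrow> complex mat \<Rightarrow> complex vec list \<Rightarrow> bool" where
  "ordered_eigenbasis n A q \<longleftrightarrow> length q = n \<and> set q \<subseteq> carrier_vec n \<and>
     (\<forall>i<n. \<forall>j<n. q ! i \<bullet>c q ! j = (if i = j then 1 else 0)) \<and>
     (\<forall>i<n. A *\<^sub>v (q ! i) = complex_of_real (eig A i) \<cdot>\<^sub>v (q ! i))"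

end

theory Submission
  imports "HOL-Analysis.Function_Topology" "HOL-Analysis.L2_Norm" Defs
begin

text \<open>Minimality is dual to the existence of a certificate: positive semidefinite \<open>P\<close>, \<open>N\<close> with
  \<open>tr P + tr N = 1\<close>, equal diagonals, \<open>A P = \<parallel>A\<parallel> P\<close> and \<open>A N = - \<parallel>A\<parallel> N\<close>. Given one,
  \<open>\<parallel>A\<parallel> = tr (A (P - N)) = tr (A(y) (P - N)) \<le> \<parallel>A(y)\<parallel>\<close>. Conversely, the pairs \<open>(P, N)\<close> of total
  trace 1 form a compact convex set. If none of them has equal diagonals and
  \<open>tr (A (P - N)) = \<parallel>A\<parallel>\<close>, then the pair closest to these conditions yields a separating
  functional, that is, a change of the diagonal that decreases the norm. If there is one, then
  \<open>tr ((\<parallel>A\<parallel> - A) P) + tr ((\<parallel>A\<parallel> + A) N) = 0\<close> with both terms nonnegative, so \<open>P\<close> and \<open>N\<close>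
  live on the extreme eigenspaces. Compressing them to these eigenspaces gives \<open>U\<close> and \<open>V\<close>
  of b), and \<open>X = P - N\<close> serves c) and d), with \<open>|X| = P + N\<close> unless \<open>A = 0\<close>.\<close>

subsection \<open>Adjoints and unitary diagonalization\<close>

text \<open>The converses of c) and d) bypass certificates. Both conditions yield tr(A X) = ||A||
  ||X||_1; a zero diagonal gives tr(A X) = tr(A(y) X), and trace duality bounds the latter by
  ||A(y)|| ||X||_1. Cancelling the trace norm requires X nonzero, which therefore belongs to c) too:
  X = 0 solves its equation for every A. The same clause excludes n = 1, A = 0, where A is minimal
  but a zero diagonal leaves only X = 0.

  A nearest pair is taken because its residual is itself the separating functional, and its
  optimality condition concerns only a quadratic polynomial on a segment. Letting P and N share the
  total trace 1 makes the pairs (W, 0) and (0, W) available, which bound one quadratic form from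
  above and from below; a one-sided bound would not control the spectral norm.

  The step from a certificate to X breaks down at A = 0: both extreme eigenspaces are the whole
  space and P - N may vanish. There any nonzero Hermitian matrix with zero diagonal serves
  instead.\<close>

lemma dim_mat_adjoint [simp]:
  "dim_row (mat_adjoint A) = dim_col A" "dim_col (mat_adjoint A) = dim_row A"
  by (simp_all add: mat_adjoint_def)

lemma index_mat_adjoint [simp]:
  fixes A :: "complex mat"
  shows "i < dim_col A \<Longrightarrow> j < dim_row A \<Longrightarrow> mat_adjoint A $$ (i, j) = cnj (A $$ (j, i))"
  by (simp add: mat_adjoint_def mat_of_rows_def)

lemma mat_adjoint_carrier [simp]: "mat_adjoint A \<in> carrier_mat m n \<longleftrightarrow> A \<in> carrier_mat n m"
  by (metis carrier_matD carrier_matI dim_mat_adjoint)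

text \<open>Versions of the library rules without an inner dimension that simp would have to guess.\<close>

lemma square_mult_carrier [simp]:
  "A \<in> carrier_mat n n \<Longrightarrow> B \<in> carrier_mat n n \<Longrightarrow> A * B \<in> carrier_mat n n"
  "A \<in> carrier_mat n n \<Longrightarrow> v \<in> carrier_vec n \<Longrightarrow> A *\<^sub>v v \<in> carrier_vec n"
  by auto

lemma square_mult_one [simp]:
  fixes A :: "'a :: semiring_1 mat"
  assumes "A \<in> carrier_mat n n"
  shows "1\<^sub>m n * A = A" "A * 1\<^sub>m n = A"
  using assms by auto

lemma mat_adjoint_adjoint [simp]: "mat_adjoint (mat_adjoint A) = (A :: complex mat)"
  by (rule eq_matI) auto

lemma index_mult_mat_sum:
  assumes "A \<in> carrier_mat n m" "B \<in> carrier_mat m k" "i < n" "j < k"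
  shows "(A * B) $$ (i, j) = (\<Sum>l<m. A $$ (i, l) * B $$ (l, j))"
  using assms by (auto simp: scalar_prod_def atLeast0LessThan intro!: sum.cong)

lemma index_mult_mat_vec_sum:
  assumes "A \<in> carrier_mat n m" "v \<in> carrier_vec m" "i < n"
  shows "(A *\<^sub>v v) $ i = (\<Sum>l<m. A $$ (i, l) * v $ l)"
  using assms by (auto simp: scalar_prod_def atLeast0LessThan intro!: sum.cong)

lemma cscalar_prod_sum:
  fixes v w :: "complex vec"
  assumes "w \<in> carrier_vec n"
  shows "v \<bullet>c w = (\<Sum>i<n. v $ i * cnj (w $ i))"
  using assms by (auto simp: scalar_prod_def atLeast0LessThan intro!: sum.cong)

lemma mat_adjoint_mult:
  fixes A B :: "complex mat"
  assumes "A \<in> carrier_mat n m" "B \<in> carrier_mat m k"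
  shows "mat_adjoint (A * B) = mat_adjoint B * mat_adjoint A"
proof (rule eq_matI)
  fix i j assume ij: "i < dim_row (mat_adjoint B * mat_adjoint A)"
    "j < dim_col (mat_adjoint B * mat_adjoint A)"
  then have *: "i < k" "j < n" using assms by auto
  show "mat_adjoint (A * B) $$ (i, j) = (mat_adjoint B * mat_adjoint A) $$ (i, j)"
    using assms * index_mult_mat_sum[OF assms *(2,1)]
      index_mult_mat_sum[of "mat_adjoint B" k m "mat_adjoint A" n i j]
    by (auto simp: mult.commute intro!: sum.cong)
qed (use assms in auto)

lemma mat_adjoint_add:
  fixes A B :: "complex mat"
  assumes "A \<in> carrier_mat n m" "B \<in> carrier_mat n m"
  shows "mat_adjoint (A + B) = mat_adjoint A + mat_adjoint B"
  using assms by (intro eq_matI) auto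

lemma mat_adjoint_minus:
  fixes A B :: "complex mat"
  assumes "A \<in> carrier_mat n m" "B \<in> carrier_mat n m"
  shows "mat_adjoint (A - B) = mat_adjoint A - mat_adjoint B"
  using assms by (intro eq_matI) auto

lemma mat_adjoint_mat_diag: "mat_adjoint (mat_diag n f) = mat_diag n (\<lambda>i. cnj (f i))"
  by (rule eq_matI) (auto simp: mat_diag_def)

lemma mat_adjoint_one [simp]: "mat_adjoint (1\<^sub>m n :: complex mat) = 1\<^sub>m n"
  by (rule eq_matI) auto

lemma cscalar_prod_mat_adjoint:
  fixes A :: "complex mat"
  assumes A: "A \<in> carrier_mat n m" and v: "v \<in> carrier_vec m" and w: "w \<in> carrier_vec n"
  shows "(A *\<^sub>v v) \<bullet>c w = v \<bullet>c (mat_adjoint A *\<^sub>v w)"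
proof -
  have "(A *\<^sub>v v) \<bullet>c w = (\<Sum>i<n. \<Sum>l<m. A $$ (i, l) * v $ l * cnj (w $ i))"
    using assms by (simp add: cscalar_prod_sum index_mult_mat_vec_sum[OF A v] sum_distrib_right
      del: index_mult_mat_vec)
  also have "\<dots> = (\<Sum>l<m. v $ l * (\<Sum>i<n. A $$ (i, l) * cnj (w $ i)))"
    by (subst sum.swap) (simp add: sum_distrib_left mult_ac)
  also have "\<dots> = v \<bullet>c (mat_adjoint A *\<^sub>v w)"
    using assms
    by (subst cscalar_prod_sum[of _ m])
      (auto intro!: mult_mat_vec_carrier simp: index_mult_mat_vec_sum[of "mat_adjoint A" m n] simp del: index_mult_mat_vec)
  finally show ?thesis .
qed

definition unitary_mat :: "nat \<Rightarrow> complex mat \<Rightarrow> bool" where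
  "unitary_mat n Q \<longleftrightarrow> Q \<in> carrier_mat n n \<and> mat_adjoint Q * Q = 1\<^sub>m n"

lemma unitary_matD:
  assumes "unitary_mat n Q"
  shows "Q \<in> carrier_mat n n" "mat_adjoint Q * Q = 1\<^sub>m n" "Q * mat_adjoint Q = 1\<^sub>m n"
  using assms mat_mult_left_right_inverse[of "mat_adjoint Q" n Q]
  unfolding unitary_mat_def by auto

lemma unitary_mat_mult:
  assumes "unitary_mat n Q" "unitary_mat n R"
  shows "unitary_mat n (Q * R)"
proof -
  note Q = unitary_matD[OF assms(1)] and R = unitary_matD[OF assms(2)]
  have "mat_adjoint (Q * R) * (Q * R) = mat_adjoint R * (mat_adjoint Q * Q) * R"
    using Q(1) R(1) by (simp add: mat_adjoint_mult assoc_mult_mat[of _ n n _ n _ n])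
  then show ?thesis using Q R unfolding unitary_mat_def by auto
qed

lemma unitary_mat_of_orthonormal:
  assumes "set ws \<subseteq> carrier_vec n" "length ws = n"
    and "\<And>i j. i < n \<Longrightarrow> j < n \<Longrightarrow> ws ! i \<bullet>c ws ! j = (if i = j then 1 else 0)"
  shows "unitary_mat n (mat_of_cols n ws)"
proof -
  let ?W = "mat_of_cols n ws"
  have W: "?W \<in> carrier_mat n n" using mat_of_cols_carrier(1)[of n ws] assms(2) by simp
  have c: "ws ! i \<in> carrier_vec n" if "i < n" for i using assms that by auto
  have "mat_adjoint ?W * ?W = 1\<^sub>m n"
  proof (rule eq_matI)
    fix i j assume "i < dim_row (1\<^sub>m n :: complex mat)" "j < dim_col (1\<^sub>m n :: complex mat)"
    then have ij: "i < n" "j < n" by auto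
    have "(mat_adjoint ?W * ?W) $$ (i, j) = (\<Sum>l<n. cnj (ws ! i $ l) * (ws ! j $ l))"
      using ij W assms(2)
      by (subst index_mult_mat_sum[of _ n n _ n]) (auto simp: mat_of_cols_index)
    also have "\<dots> = ws ! j \<bullet>c ws ! i"
      using c[OF ij(1)] by (simp add: cscalar_prod_sum mult.commute)
    finally show "(mat_adjoint ?W * ?W) $$ (i, j) = 1\<^sub>m n $$ (i, j)"
      using ij assms(3) by auto
  qed (use W in auto)
  with W show ?thesis unfolding unitary_mat_def by auto
qed

text \<open>Supplies the change of basis for deflation. Gram-Schmidt keeps the head of the list, and
  the normalization afterwards only rescales it; \<open>c\<close> is that scaling factor.\<close>

lemma orthonormal_extension:
  fixes v :: "complex vec"
  assumes v: "v \<in> carrier_vec n" and v0: "v \<noteq> 0\<^sub>v n"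
  shows "\<exists>W c. unitary_mat n W \<and> c \<noteq> 0 \<and> col W 0 = c \<cdot>\<^sub>v v"
proof -
  interpret cof_vec_space n "TYPE(complex)" .
  define b where "b = basis_completion v"
  define ws where "ws = gram_schmidt n b"
  from basis_completion[OF v v0, folded b_def]
  have dist_b: "distinct b" and indep: "\<not> lin_dep (set b)" and b: "set b \<subseteq> carrier_vec n"
    and hdb: "hd b = v" and len_b: "length b = n" by auto
  have n: "n \<noteq> 0" using v v0 by auto
  from hdb len_b n obtain vs where bv: "b = v # vs" by (cases b) auto
  from gram_schmidt_result[OF b dist_b indep refl, folded ws_def]
  have ws: "set ws \<subseteq> carrier_vec n" "corthogonal ws" "length ws = n"
    by (auto simp: len_b)
  from gram_schmidt_hd[OF v, of vs, folded bv] have hdws: "hd ws = v" unfolding ws_def .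
  define g where "g w = complex_of_real (1 / sqrt (Re (w \<bullet>c w)))" for w
  define us where "us = map (\<lambda>w. g w \<cdot>\<^sub>v w) ws"
  have c: "ws ! i \<in> carrier_vec n" if "i < n" for i using ws that by auto
  have sq: "ws ! i \<bullet>c ws ! i = complex_of_real (Re (ws ! i \<bullet>c ws ! i))" 
    "Re (ws ! i \<bullet>c ws ! i) > 0" if "i < n" for i
  proof -
    have "ws ! i \<bullet>c ws ! i = (\<Sum>l<n. complex_of_real ((cmod (ws ! i $ l))\<^sup>2))"
      using c[OF that] by (simp add: cscalar_prod_sum complex_norm_square del: of_real_power)
    then have *: "ws ! i \<bullet>c ws ! i = complex_of_real (\<Sum>l<n. (cmod (ws ! i $ l))\<^sup>2)" by simp
    then show "ws ! i \<bullet>c ws ! i = complex_of_real (Re (ws ! i \<bullet>c ws ! i))" by simp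
    have "ws ! i \<bullet>c ws ! i \<noteq> 0" using corthogonalD[OF ws(2)] that ws(3) by auto
    then have "(\<Sum>l<n. (cmod (ws ! i $ l))\<^sup>2) \<noteq> 0" unfolding * by (metis of_real_0)
    moreover have "(\<Sum>l<n. (cmod (ws ! i $ l))\<^sup>2) \<ge> 0" by (simp add: sum_nonneg)
    ultimately show "Re (ws ! i \<bullet>c ws ! i) > 0" unfolding * by (simp add: less_le)
  qed
  have "us ! i \<bullet>c us ! j = (if i = j then 1 else 0)" if ij: "i < n" "j < n" for i j
  proof -
    have "us ! i \<bullet>c us ! j = g (ws ! i) * cnj (g (ws ! j)) * (ws ! i \<bullet>c ws ! j)"
      using ij c[OF ij(1)] c[OF ij(2)] ws(3) by (simp add: us_def cscalar_prod_sum[of _ n] sum_distrib_left mult_ac)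
    moreover have "ws ! i \<bullet>c ws ! j = 0" if "i \<noteq> j"
      using corthogonalD[OF ws(2)] that ws(3) ij by auto
    moreover have "g (ws ! i) * cnj (g (ws ! i)) * (ws ! i \<bullet>c ws ! i) = 1"
    proof -
      have "g (ws ! i) * cnj (g (ws ! i)) * (ws ! i \<bullet>c ws ! i) 
        = complex_of_real ((1 / sqrt (Re (ws ! i \<bullet>c ws ! i))) * (1 / sqrt (Re (ws ! i \<bullet>c ws ! i)))
            * Re (ws ! i \<bullet>c ws ! i))"
        unfolding g_def using sq(1)[OF ij(1)] by (metis complex_cnj_complex_of_real of_real_mult)
      also have "\<dots> = 1" using sq(2)[OF ij(1)] by (simp add: field_simps)
      finally show ?thesis .
    qed
    ultimately show ?thesis by auto
  qed
  then have "unitary_mat n (mat_of_cols n us)"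
    using ws by (intro unitary_mat_of_orthonormal) (auto simp: us_def)
  moreover have "ws ! 0 = v" using hdws n ws(3) by (cases ws) auto
  then have "col (mat_of_cols n us) 0 = g v \<cdot>\<^sub>v v"
    using n ws v by (subst col_mat_of_cols) (auto simp: us_def)
  moreover have "g v \<noteq> 0" using sq(2)[of 0] n \<open>ws ! 0 = v\<close> by (simp add: g_def)
  ultimately show ?thesis by blast
qed

lemma mult_block_diag:
  fixes A B C D :: "'a :: comm_ring_1 mat"
  assumes "A \<in> carrier_mat k k" "B \<in> carrier_mat m m" "C \<in> carrier_mat k k" "D \<in> carrier_mat m m"
  shows "four_block_mat A (0\<^sub>m k m) (0\<^sub>m m k) B * four_block_mat C (0\<^sub>m k m) (0\<^sub>m m k) D
    = four_block_mat (A * C) (0\<^sub>m k m) (0\<^sub>m m k) (B * D)"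
  using assms by (subst mult_four_block_mat[of _ k k _ m _ m _ _ k _ m])
    (auto simp: left_mult_zero_mat[of _ _ k] left_mult_zero_mat[of _ _ m]
      right_mult_zero_mat[of _ k] right_mult_zero_mat[of _ m])

text \<open>Deflation: a unitary conjugation moves an eigenvector for the first root to the first
  basis vector, and self-adjointness clears the first row together with the first column. The
  induction runs over an arbitrary factorization list so that the diagonal comes out in a prescribed
  order, later the decreasing one.\<close>

lemma hermitian_diagonalization:
  assumes "hermitian_mat n A" and "char_poly A = (\<Prod>e\<leftarrow>es. [:- e, 1:])"
  shows "\<exists>Q. unitary_mat n Q \<and> A = Q * mat_diag n (\<lambda>i. es ! i) * mat_adjoint Q"
  using assms
proof (induct es arbitrary: n A)
  case Nil
  have A: "A \<in> carrier_mat n n" using Nil(1) by (simp add: hermitian_mat_def)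
  have "n = 0" using degree_monic_char_poly[OF A] Nil(2) by simp
  then have "unitary_mat n (1\<^sub>m n)" "A = 1\<^sub>m n * mat_diag n (\<lambda>i. [] ! i) * mat_adjoint (1\<^sub>m n)"
    using A by (auto simp: unitary_mat_def mat_diag_def intro!: eq_matI)
  then show ?case by blast
next
  case (Cons e es n A)
  have A: "A \<in> carrier_mat n n" and adjA: "mat_adjoint A = A"
    using Cons(2) by (auto simp: hermitian_mat_def)
  have cp: "char_poly A = [:- e, 1:] * (\<Prod>e\<leftarrow>es. [:- e, 1:])" using Cons(3) by simp
  have ev: "eigenvalue A e" unfolding eigenvalue_root_char_poly[OF A] cp by simp
  from find_eigenvector[OF A ev] obtain v where v: "v \<in> carrier_vec n" "v \<noteq> 0\<^sub>v n"
    "A *\<^sub>v v = e \<cdot>\<^sub>v v" using A unfolding eigenvector_def by auto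
  have n: "n \<noteq> 0" using v by auto
  let ?m = "n - 1"
  from orthonormal_extension[OF v(1,2)] obtain W c where
    uW: "unitary_mat n W" and c: "c \<noteq> 0" and colW: "col W 0 = c \<cdot>\<^sub>v v" by blast
  note W = unitary_matD[OF uW]
  have aW: "mat_adjoint W \<in> carrier_mat n n" using W(1) by simp
  define A' where "A' = mat_adjoint W * (A * W)"
  have A': "A' \<in> carrier_mat n n" using A W(1) by (simp add: A'_def)
  have adjA': "mat_adjoint A' = A'"
    using A W(1) unfolding A'_def
    by (simp add: mat_adjoint_mult[of _ n n _ n] adjA assoc_mult_mat[of _ n n _ n _ n])
  have AA': "A = W * A' * mat_adjoint W"
  proof -
    have "W * A' * mat_adjoint W = (W * mat_adjoint W) * A * (W * mat_adjoint W)"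
      using A W(1) aW unfolding A'_def by (simp add: assoc_mult_mat[of _ n n _ n _ n])
    then show ?thesis using A W by simp
  qed
  have Acol: "A *\<^sub>v col W 0 = e \<cdot>\<^sub>v col W 0"
    using v A by (simp add: colW mult_mat_vec smult_smult_assoc mult.commute)
  have A'0: "A' $$ (i, 0) = (if i = 0 then e else 0)" if i: "i < n" for i
  proof -
    have AW: "(A * W) $$ (k, 0) = e * W $$ (k, 0)" if "k < n" for k
    proof -
      have "(A * W) $$ (k, 0) = (A *\<^sub>v col W 0) $ k" using A W(1) n that by simp
      then show ?thesis unfolding Acol using W(1) n that by simp
    qed
    have "A' $$ (i, 0) = (\<Sum>k<n. mat_adjoint W $$ (i, k) * (A * W) $$ (k, 0))"
      unfolding A'_def using A W(1) i n by (subst index_mult_mat_sum[of _ n n _ n]) auto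
    also have "\<dots> = e * (\<Sum>k<n. mat_adjoint W $$ (i, k) * W $$ (k, 0))"
      by (simp add: sum_distrib_left AW mult_ac)
    also have "(\<Sum>k<n. mat_adjoint W $$ (i, k) * W $$ (k, 0)) = (mat_adjoint W * W) $$ (i, 0)"
      using W(1) i n by (subst index_mult_mat_sum[of _ n n _ n]) auto
    finally show ?thesis using W(2) i n by auto
  qed
  have A'0': "A' $$ (0, i) = (if i = 0 then cnj e else 0)" if i: "i < n" for i
  proof -
    have "A' $$ (0, i) = mat_adjoint A' $$ (0, i)" by (simp add: adjA')
    also have "\<dots> = cnj (A' $$ (i, 0))" using A' i n by (subst index_mat_adjoint) auto
    finally show ?thesis using A'0[OF i] by auto
  qed
  \<comment> \<open>The corner entry belongs to both the first row and the first column, so the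
    eigenvalue is real.\<close>
  have cnj_e: "cnj e = e" using A'0[of 0] A'0'[of 0] n by simp
  define A1 where "A1 = mat 1 1 (\<lambda>_. e)"
  define A3 where "A3 = mat ?m ?m (\<lambda>(i, j). A' $$ (Suc i, Suc j))"
  have A1: "A1 \<in> carrier_mat 1 1" and A3: "A3 \<in> carrier_mat ?m ?m"
    by (auto simp: A1_def A3_def)
  have blk: "A' = four_block_mat A1 (0\<^sub>m 1 ?m) (0\<^sub>m ?m 1) A3"
    using A' A'0 A'0' n cnj_e
    by (intro eq_matI) (auto simp: A1_def A3_def)
  have hA3: "hermitian_mat ?m A3"
  proof -
    have "mat_adjoint A3 = A3"
    proof (rule eq_matI)
      fix i j assume "i < dim_row A3" "j < dim_col A3"
      then have ij: "Suc i < n" "Suc j < n" "i < ?m" "j < ?m" by (auto simp: A3_def)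
      have "A' $$ (Suc i, Suc j) = mat_adjoint A' $$ (Suc i, Suc j)" by (simp add: adjA')
      also have "\<dots> = cnj (A' $$ (Suc j, Suc i))" using A' ij by (subst index_mat_adjoint) auto
      finally show "mat_adjoint A3 $$ (i, j) = A3 $$ (i, j)" using ij by (simp add: A3_def)
    qed (auto simp: A3_def)
    then show ?thesis using A3 by (simp add: hermitian_mat_def)
  qed
  have "similar_mat_wit A A' W (mat_adjoint W)"
    by (rule similar_mat_witI[of _ _ n]) (use W A A' AA' in auto)
  then have "char_poly A = char_poly A'"
    by (intro char_poly_similar) (auto simp: similar_mat_def)
  also have "\<dots> = char_poly A1 * char_poly A3"
    unfolding blk by (rule char_poly_four_block_zeros_col[OF A1 _ A3]) simp
  also have "char_poly A1 = [:- e, 1:]"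
    by (simp add: A1_def char_poly_defs det_def sign_def)
  \<comment> \<open>Cancelling the linear factor leaves exactly the tail of the list as the roots of
    the smaller block.\<close>
  finally have "char_poly A3 = (\<Prod>e\<leftarrow>es. [:- e, 1:])" unfolding cp
    by (metis mult_cancel_left pCons_eq_0_iff zero_neq_one)
  from Cons(1)[OF hA3 this] obtain P where uP: "unitary_mat ?m P"
    and A3P: "A3 = P * mat_diag ?m (\<lambda>i. es ! i) * mat_adjoint P" by blast
  note P = unitary_matD[OF uP]
  let ?D' = "mat_diag ?m (\<lambda>i. es ! i)"
  let ?D = "mat_diag n (\<lambda>i. (e # es) ! i)"
  define F where "F = four_block_mat (1\<^sub>m 1) (0\<^sub>m 1 ?m) (0\<^sub>m ?m 1) P"
  have F: "F \<in> carrier_mat n n" using P(1) n by (auto simp: F_def)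
  have adjF: "mat_adjoint F = four_block_mat (1\<^sub>m 1) (0\<^sub>m 1 ?m) (0\<^sub>m ?m 1) (mat_adjoint P)"
    using P(1) n by (intro eq_matI) (auto simp: F_def)
  have D: "?D = four_block_mat A1 (0\<^sub>m 1 ?m) (0\<^sub>m ?m 1) ?D'"
    using n by (intro eq_matI) (auto simp: A1_def mat_diag_def nth_Cons' )
  have D': "?D' \<in> carrier_mat ?m ?m" "?D \<in> carrier_mat n n" by auto
  have "mat_adjoint F * F = four_block_mat (1\<^sub>m 1) (0\<^sub>m 1 ?m) (0\<^sub>m ?m 1) (1\<^sub>m ?m)"
    unfolding adjF unfolding F_def using P by (subst mult_block_diag) auto
  also have "\<dots> = 1\<^sub>m n" using n by (intro eq_matI) auto
  finally have uF: "unitary_mat n F" using F by (simp add: unitary_mat_def)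
  have "F * ?D * mat_adjoint F = four_block_mat A1 (0\<^sub>m 1 ?m) (0\<^sub>m ?m 1) (P * ?D' * mat_adjoint P)"
    unfolding adjF unfolding D F_def using P A1 D'
    by (simp add: mult_block_diag del: One_nat_def)
  then have FD: "F * ?D * mat_adjoint F = A'" unfolding blk A3P .
  have "W * F * ?D * mat_adjoint (W * F) = W * (F * ?D * mat_adjoint F) * mat_adjoint W"
    using W(1) aW F D'(2)
    by (simp add: mat_adjoint_mult[of _ n n _ n] assoc_mult_mat[of _ n n _ n _ n])
  then have "A = W * F * ?D * mat_adjoint (W * F)" unfolding FD AA'[symmetric] by simp
  then show ?case using unitary_mat_mult[OF uW uF] by blast
qed

text \<open>Functional calculus in a fixed eigenbasis: square roots, spectral projections and shifts
  of a Hermitian matrix all arise by changing \<open>d\<close> while keeping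
  \<open>Q\<close>.\<close>

definition herm_fun :: "nat \<Rightarrow> complex mat \<Rightarrow> (nat \<Rightarrow> real) \<Rightarrow> complex mat" where
  "herm_fun n Q d = Q * mat_diag n (\<lambda>i. complex_of_real (d i)) * mat_adjoint Q"

lemma herm_fun_carrier [simp]: "Q \<in> carrier_mat n n \<Longrightarrow> herm_fun n Q d \<in> carrier_mat n n"
  by (auto simp: herm_fun_def)

lemma dim_herm_fun [simp]:
  "dim_row (herm_fun n Q d) = dim_row Q" "dim_col (herm_fun n Q d) = dim_row Q"
  by (simp_all add: herm_fun_def)

lemma herm_fun_cong:
  assumes "\<And>i. i < n \<Longrightarrow> d i = e i"
  shows "herm_fun n Q d = herm_fun n Q e"
proof -
  have "mat_diag n (\<lambda>i. complex_of_real (d i)) = mat_diag n (\<lambda>i. complex_of_real (e i))"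
    using assms by (intro eq_matI) (auto simp: mat_diag_def)
  then show ?thesis by (simp add: herm_fun_def)
qed

lemma hermitian_herm_fun:
  assumes "Q \<in> carrier_mat n n"
  shows "hermitian_mat n (herm_fun n Q d)"
  using assms
  by (simp add: hermitian_mat_def herm_fun_def mat_adjoint_mult[of _ n n _ n] mat_adjoint_mat_diag
      assoc_mult_mat[of _ n n _ n _ n])

lemma herm_fun_mult:
  assumes "unitary_mat n Q"
  shows "herm_fun n Q d * herm_fun n Q e = herm_fun n Q (\<lambda>i. d i * e i)"
proof -
  note Q = unitary_matD[OF assms]
  let ?D = "\<lambda>d. mat_diag n (\<lambda>i. complex_of_real (d i))"
  have "herm_fun n Q d * herm_fun n Q e = Q * ?D d * (mat_adjoint Q * Q) * ?D e * mat_adjoint Q"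
    using Q(1) by (simp add: herm_fun_def assoc_mult_mat[of _ n n _ n _ n])
  also have "\<dots> = Q * (?D d * ?D e) * mat_adjoint Q"
    using Q(1) by (simp add: Q(2) assoc_mult_mat[of _ n n _ n _ n] del: mat_diag_diag)
  finally show ?thesis by (simp add: herm_fun_def)
qed

lemma herm_fun_mult_unitary:
  assumes "unitary_mat n Q"
  shows "herm_fun n Q d * Q = Q * mat_diag n (\<lambda>i. complex_of_real (d i))"
  using unitary_matD[OF assms]
  by (simp add: herm_fun_def assoc_mult_mat[of _ n n _ n _ n])

text \<open>The columns of \<open>Q\<close> form a basis, so a matrix that scales each of them by
  \<open>d i\<close> is determined.\<close>

lemma herm_funI:
  assumes "unitary_mat n Q" "A \<in> carrier_mat n n"
    and "A * Q = Q * mat_diag n (\<lambda>i. complex_of_real (d i))"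
  shows "A = herm_fun n Q d"
proof -
  note Q = unitary_matD[OF assms(1)]
  have "A = A * (Q * mat_adjoint Q)" using Q assms(2) by simp
  also have "\<dots> = A * Q * mat_adjoint Q" using Q(1) assms(2)
    by (simp add: assoc_mult_mat[of _ n n _ n _ n])
  finally show ?thesis by (simp add: assms(3) herm_fun_def)
qed

lemma herm_fun_col:
  assumes "unitary_mat n Q" "i < n"
  shows "herm_fun n Q d *\<^sub>v col Q i = complex_of_real (d i) \<cdot>\<^sub>v col Q i"
proof -
  note Q = unitary_matD[OF assms(1)]
  have "herm_fun n Q d *\<^sub>v col Q i = col (herm_fun n Q d * Q) i"
    using Q(1) assms(2) by (simp add: col_mult2[of _ n n _ n])
  also have "\<dots> = complex_of_real (d i) \<cdot>\<^sub>v col Q i"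
    using Q(1) assms(2)
    by (intro eq_vecI) (auto simp: herm_fun_mult_unitary[OF assms(1)] mat_diag_mult_right[of _ n])
  finally show ?thesis .
qed

lemma col_unitary_orthonormal:
  assumes "unitary_mat n Q" "i < n" "j < n"
  shows "col Q i \<bullet>c col Q j = (if i = j then 1 else 0)"
proof -
  note Q = unitary_matD[OF assms(1)]
  have "(mat_adjoint Q * Q) $$ (j, i) = col Q i \<bullet>c col Q j"
    using Q(1) assms(2,3)
    by (subst index_mult_mat_sum[of _ n n _ n]) (auto simp: cscalar_prod_sum[of _ n] mult.commute)
  then show ?thesis using Q(2) assms(2,3) by auto
qed

section \<open>Inner products and norms in eigenbasis coordinates\<close>

lemma mat_diag_mult_vec:
  assumes "v \<in> carrier_vec n"
  shows "mat_diag n f *\<^sub>v v = vec n (\<lambda>i. f i * v $ i)"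
proof (rule eq_vecI)
  fix i assume "i < dim_vec (vec n (\<lambda>i. f i * v $ i))"
  then have i: "i < n" by simp
  have "(mat_diag n f *\<^sub>v v) $ i = (\<Sum>l<n. (if i = l then f l * v $ l else 0))"
    unfolding index_mult_mat_vec_sum[OF mat_diag_dim assms i]
    using assms i by (intro sum.cong) (auto simp: mat_diag_def)
  then show "(mat_diag n f *\<^sub>v v) $ i = vec n (\<lambda>i. f i * v $ i) $ i" using i by simp
qed (auto simp: mat_diag_def)

lemma cscalar_prod_self: 
  assumes "v \<in> carrier_vec n"
  shows "v \<bullet>c v = complex_of_real (\<Sum>i<n. (cmod (v $ i))\<^sup>2)"
  using assms by (simp add: cscalar_prod_sum complex_norm_square del: of_real_power)

lemma vec_norm2_sq: "v \<in> carrier_vec n \<Longrightarrow> (vec_norm2 v)\<^sup>2 = (\<Sum>i<n. (cmod (v $ i))\<^sup>2)"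
  by (simp add: vec_norm2_def cscalar_prod_self sum_nonneg)

lemma vec_norm2_nonneg [simp]: "vec_norm2 v \<ge> 0"
  using cscalar_prod_self[of v "dim_vec v"] by (simp add: vec_norm2_def sum_nonneg)

lemma vec_norm2_L2: "v \<in> carrier_vec n \<Longrightarrow> vec_norm2 v = L2_set (\<lambda>i. cmod (v $ i)) {..<n}"
  by (simp add: vec_norm2_def cscalar_prod_self L2_set_def)

lemma cmod_cscalar_prod_le:
  fixes v w :: "complex vec"
  assumes "v \<in> carrier_vec n" "w \<in> carrier_vec n"
  shows "cmod (v \<bullet>c w) \<le> vec_norm2 v * vec_norm2 w"
proof -
  have "cmod (v \<bullet>c w) \<le> (\<Sum>i<n. \<bar>cmod (v $ i)\<bar> * \<bar>cmod (w $ i)\<bar>)"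
    unfolding cscalar_prod_sum[OF assms(2)] by (rule norm_sum[THEN order_trans]) (simp add: norm_mult)
  also have "\<dots> \<le> vec_norm2 v * vec_norm2 w"
    unfolding vec_norm2_L2[OF assms(1)] vec_norm2_L2[OF assms(2)] by (rule L2_set_mult_ineq)
  finally show ?thesis .
qed

text \<open>In the coordinates \<open>w\<close> the matrix is diagonal, and unitarity preserves
  inner products. Norm bounds and positivity thereby become inequalities between weighted sums of
  squares.\<close>

lemma herm_fun_norm:
  assumes "unitary_mat n Q" "v \<in> carrier_vec n"
  defines "w \<equiv> mat_adjoint Q *\<^sub>v v"
  shows "(vec_norm2 (herm_fun n Q d *\<^sub>v v))\<^sup>2 = (\<Sum>i<n. (d i)\<^sup>2 * (cmod (w $ i))\<^sup>2)"
    and "(vec_norm2 v)\<^sup>2 = (\<Sum>i<n. (cmod (w $ i))\<^sup>2)"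
    and "(herm_fun n Q d *\<^sub>v v) \<bullet>c v = complex_of_real (\<Sum>i<n. d i * (cmod (w $ i))\<^sup>2)"
proof -
  note Q = unitary_matD[OF assms(1)]
  have w: "w \<in> carrier_vec n" using Q(1) assms(2) by (simp add: w_def)
  have iso: "(Q *\<^sub>v x) \<bullet>c (Q *\<^sub>v y) = x \<bullet>c y" if "x \<in> carrier_vec n" "y \<in> carrier_vec n" for x y
  proof -
    have "(Q *\<^sub>v x) \<bullet>c (Q *\<^sub>v y) = x \<bullet>c ((mat_adjoint Q * Q) *\<^sub>v y)"
      using Q(1) that by (simp add: cscalar_prod_mat_adjoint[of _ n n] assoc_mult_mat_vec[of _ n n _ n])
    then show ?thesis using Q(2) that by simp
  qed
  have v: "v = Q *\<^sub>v w"
    using Q assms(2) by (simp add: w_def assoc_mult_mat_vec[of _ n n _ n, symmetric])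
  let ?D = "mat_diag n (\<lambda>i. complex_of_real (d i))"
  have Dw: "?D *\<^sub>v w \<in> carrier_vec n" using w by simp
  have hv: "herm_fun n Q d *\<^sub>v v = Q *\<^sub>v (?D *\<^sub>v w)"
    using Q assms(2) w by (simp add: herm_fun_def w_def assoc_mult_mat_vec[of _ n n _ n])
  have nQ: "vec_norm2 (Q *\<^sub>v x) = vec_norm2 x" if "x \<in> carrier_vec n" for x
    using iso[OF that that] by (simp add: vec_norm2_def)
  show "(vec_norm2 (herm_fun n Q d *\<^sub>v v))\<^sup>2 = (\<Sum>i<n. (d i)\<^sup>2 * (cmod (w $ i))\<^sup>2)"
    unfolding hv nQ[OF Dw] vec_norm2_sq[OF Dw]
    using w by (simp add: mat_diag_mult_vec norm_mult power_mult_distrib)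
  show "(vec_norm2 v)\<^sup>2 = (\<Sum>i<n. (cmod (w $ i))\<^sup>2)"
    by (subst v, subst nQ[OF w]) (rule vec_norm2_sq[OF w])
  have "(herm_fun n Q d *\<^sub>v v) \<bullet>c v = (?D *\<^sub>v w) \<bullet>c w"
    unfolding hv by (subst v, rule iso[OF Dw w])
  also have "\<dots> = (\<Sum>i<n. complex_of_real (d i) * (w $ i * cnj (w $ i)))"
    using w by (simp add: cscalar_prod_sum mat_diag_mult_vec mult.assoc)
  also have "\<dots> = complex_of_real (\<Sum>i<n. d i * (cmod (w $ i))\<^sup>2)"
    by (simp add: complex_norm_square del: of_real_power)
  finally show "(herm_fun n Q d *\<^sub>v v) \<bullet>c v = complex_of_real (\<Sum>i<n. d i * (cmod (w $ i))\<^sup>2)" .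
qed

lemma psd_herm_fun:
  assumes "unitary_mat n Q" "\<And>i. i < n \<Longrightarrow> 0 \<le> d i"
  shows "psd_mat n (herm_fun n Q d)"
  using assms unitary_matD(1)[OF assms(1)]
  by (auto simp: psd_mat_def hermitian_herm_fun herm_fun_norm(3) intro!: sum_nonneg)

lemma psd_herm_fun_nonneg:
  assumes "unitary_mat n Q" "psd_mat n (herm_fun n Q d)" "i < n"
  shows "0 \<le> d i"
proof -
  note Q = unitary_matD[OF assms(1)]
  have c: "col Q i \<in> carrier_vec n" using Q(1) assms(3) by auto
  then have "0 \<le> Re ((herm_fun n Q d *\<^sub>v col Q i) \<bullet>c col Q i)"
    using assms(2) by (auto simp: psd_mat_def)
  also have "(herm_fun n Q d *\<^sub>v col Q i) \<bullet>c col Q i = complex_of_real (d i) * (col Q i \<bullet>c col Q i)"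
    unfolding herm_fun_col[OF assms(1,3)] using c by (simp add: smult_scalar_prod_distrib[of _ n])
  finally show ?thesis using col_unitary_orthonormal[OF assms(1,3,3)] by simp
qed

subsection \<open>Eigenvalues and the spectral norm\<close>

lemma proots_linear_factors:
  fixes as :: "'a :: idom list"
  shows "proots (\<Prod>a\<leftarrow>as. [:- a, 1:]) = mset as"
proof (induct as)
  case (Cons a as)
  have "(\<Prod>a\<leftarrow>as. [:- a, 1:]) \<noteq> 0" by (auto simp: prod_list_zero_iff)
  then have "proots ([:- a, 1:] * (\<Prod>a\<leftarrow>as. [:- a, 1:])) = proots [:- a, 1:] + mset as"
    using Cons by (subst proots_mult) auto
  then show ?case by simp
qed simp

text \<open>\<open>eig\<close> sorts the real parts of the roots. Nothing is lost by this: the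
  diagonal matrix Q^* A Q is self-adjoint, so the roots are real. Since a product does not depend on
  the order of its factors, the sorted list is also a valid input for
  \<open>hermitian_diagonalization\<close>.\<close>

lemma char_poly_eq_eig:
  assumes "hermitian_mat n A"
  shows "\<exists>rs. length rs = n \<and> sorted (rev rs) \<and> (\<forall>i<n. eig A i = rs ! i) \<and>
    proots (char_poly A) = mset (map complex_of_real rs) \<and>
    char_poly A = (\<Prod>e\<leftarrow>map complex_of_real rs. [:- e, 1:])"
proof -
  have A: "A \<in> carrier_mat n n" and adjA: "mat_adjoint A = A"
    using assms by (auto simp: hermitian_mat_def)
  from char_poly_factorized[OF A] obtain as
    where as: "char_poly A = (\<Prod>a\<leftarrow>as. [:- a, 1:])" "length as = n" by blast
  from hermitian_diagonalization[OF assms as(1)] obtain Q where uQ: "unitary_mat n Q"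
    and AQ: "A = Q * mat_diag n (\<lambda>i. as ! i) * mat_adjoint Q" by blast
  note Q = unitary_matD[OF uQ]
  let ?D = "mat_diag n (\<lambda>i. as ! i)"
  have D: "?D = mat_adjoint Q * A * Q"
  proof -
    have "mat_adjoint Q * A * Q = (mat_adjoint Q * Q) * ?D * (mat_adjoint Q * Q)"
      unfolding AQ using Q(1) by (simp add: assoc_mult_mat[of _ n n _ n _ n])
    then show ?thesis using Q by simp
  qed
  have "mat_adjoint ?D = ?D" unfolding D using Q(1) A
    by (simp add: mat_adjoint_mult[of _ n n _ n] adjA assoc_mult_mat[of _ n n _ n _ n])
  then have real: "cnj (as ! i) = as ! i" if "i < n" for i
  proof -
    have "cnj (as ! i) = mat_adjoint ?D $$ (i, i)" using that by (simp add: mat_adjoint_mat_diag) (simp add: mat_diag_def)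
    also have "\<dots> = as ! i" using \<open>mat_adjoint ?D = ?D\<close> that by (simp add: mat_diag_def)
    finally show ?thesis .
  qed
  then have "map (\<lambda>a. complex_of_real (Re a)) as = as"
    using as(2) by (intro nth_equalityI) (auto simp: complex_eq_iff)
  then have Re_as: "map complex_of_real (map Re as) = as" by (simp add: comp_def)
  have pr: "proots (char_poly A) = mset as"
    unfolding as(1) by (rule proots_linear_factors)
  define rs where "rs = rev (sorted_list_of_multiset (image_mset Re (mset as)))"
  have "mset rs = mset (map Re as)" by (simp add: rs_def)
  then have "image_mset complex_of_real (mset rs) = image_mset complex_of_real (mset (map Re as))" by simp
  then have m: "mset (map complex_of_real rs) = mset as" using Re_as by (metis mset_map)
  have "length rs = n" using mset_eq_length[OF m] as(2) by simp
  moreover have "sorted (rev rs)" by (simp add: rs_def)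
  moreover have "\<forall>i<n. eig A i = rs ! i" by (simp add: eig_def pr rs_def)
  moreover have "char_poly A = (\<Prod>e\<leftarrow>map complex_of_real rs. [:- e, 1:])"
    unfolding as(1) by (metis (no_types) m mset_map prod_mset_prod_list)
  ultimately show ?thesis using pr m by auto
qed

lemma hermitian_spectral:
  assumes "hermitian_mat n A"
  obtains Q where "unitary_mat n Q" "A = herm_fun n Q (eig A)"
proof -
  from char_poly_eq_eig[OF assms] obtain rs where rs: "length rs = n" "\<forall>i<n. eig A i = rs ! i"
    "char_poly A = (\<Prod>e\<leftarrow>map complex_of_real rs. [:- e, 1:])" by blast
  from hermitian_diagonalization[OF assms rs(3)] obtain Q where "unitary_mat n Q"
    and "A = Q * mat_diag n (\<lambda>i. map complex_of_real rs ! i) * mat_adjoint Q" by blast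
  moreover have "mat_diag n (\<lambda>i. map complex_of_real rs ! i) = mat_diag n (\<lambda>i. complex_of_real (eig A i))"
    using rs by (intro eq_matI) (auto simp: mat_diag_def)
  ultimately show ?thesis using that by (simp add: herm_fun_def)
qed

lemma eig_antimono:
  assumes "hermitian_mat n A" "i \<le> j" "j < n"
  shows "eig A j \<le> eig A i"
proof -
  from char_poly_eq_eig[OF assms(1)] obtain rs where "length rs = n" "sorted (rev rs)"
    "\<forall>i<n. eig A i = rs ! i" by blast
  with sorted_rev_nth_mono[of rs i j] assms(2,3) show ?thesis by simp
qed

lemma eig_mult_eq_card:
  assumes "hermitian_mat n A"
  shows "eig_mult A a = card {i. i < n \<and> eig A i = a}"
proof -
  from char_poly_eq_eig[OF assms] obtain rs where rs: "length rs = n" "\<forall>i<n. eig A i = rs ! i"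
    "proots (char_poly A) = mset (map complex_of_real rs)" by blast
  have "char_poly A \<noteq> 0" using degree_monic_char_poly[of A n] assms
    by (auto simp: hermitian_mat_def)
  then have "eig_mult A a = count (mset (map complex_of_real rs)) (complex_of_real a)"
    unfolding eig_mult_def rs(3)[symmetric] by (rule count_proots[symmetric])
  also have "\<dots> = length (filter (\<lambda>r. r = a) rs)" by (induct rs) auto
  also have "\<dots> = card {i. i < n \<and> eig A i = a}"
    unfolding length_filter_conv_card using rs by (intro arg_cong[of _ _ card]) auto
  finally show ?thesis .
qed

lemma cscalar_prod_norm: "v \<in> carrier_vec n \<Longrightarrow> v \<bullet>c v = complex_of_real ((vec_norm2 v)\<^sup>2)"
  by (simp only: cscalar_prod_self vec_norm2_sq)

lemma vec_norm2_smult: "vec_norm2 (c \<cdot>\<^sub>v v) = cmod c * vec_norm2 v"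
proof -
  have "(vec_norm2 (c \<cdot>\<^sub>v v))\<^sup>2 = (cmod c * vec_norm2 v)\<^sup>2"
    by (simp add: vec_norm2_sq[of _ "dim_vec v"] norm_mult power_mult_distrib sum_distrib_left)
  then show ?thesis by (metis mult_nonneg_nonneg norm_ge_zero power2_eq_imp_eq vec_norm2_nonneg)
qed

lemma vec_norm2_col_unitary:
  assumes "unitary_mat n Q" "i < n"
  shows "vec_norm2 (col Q i) = 1"
  using col_unitary_orthonormal[OF assms assms(2)] by (simp add: vec_norm2_def)

lemma vec_norm2_unit_vec: "i < n \<Longrightarrow> vec_norm2 (unit_vec n i) = 1"
  by (simp add: vec_norm2_def cscalar_prod_self[of _ n] if_distrib[of "\<lambda>x. (cmod x)\<^sup>2"] cong: if_cong)

lemma herm_fun_norm_le: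
  assumes "unitary_mat n Q" "v \<in> carrier_vec n" "0 \<le> w" "\<And>i. i < n \<Longrightarrow> \<bar>d i\<bar> \<le> w"
  shows "vec_norm2 (herm_fun n Q d *\<^sub>v v) \<le> w * vec_norm2 v"
proof (rule power2_le_imp_le)
  have "(d i)\<^sup>2 \<le> w\<^sup>2" if "i < n" for i
    using assms(4)[OF that] assms(3) abs_le_square_iff[of "d i" w] by simp
  then show "(vec_norm2 (herm_fun n Q d *\<^sub>v v))\<^sup>2 \<le> (w * vec_norm2 v)\<^sup>2"
    unfolding power_mult_distrib herm_fun_norm(1,2)[OF assms(1,2)] sum_distrib_left
    by (intro sum_mono mult_right_mono) auto
qed (use assms(3) in simp)

lemma hermitian_norm_le:
  assumes "hermitian_mat n A" "v \<in> carrier_vec n" "0 \<le> w" "\<And>i. i < n \<Longrightarrow> \<bar>eig A i\<bar> \<le> w"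
  shows "vec_norm2 (A *\<^sub>v v) \<le> w * vec_norm2 v"
  using hermitian_spectral[OF assms(1)] herm_fun_norm_le assms(2-4) by metis

lemma spectral_norm_upper:
  assumes "hermitian_mat n A" "v \<in> carrier_vec n" "vec_norm2 v = 1"
  shows "vec_norm2 (A *\<^sub>v v) \<le> spectral_norm A"
proof -
  let ?S = "{vec_norm2 (A *\<^sub>v v) | v. v \<in> carrier_vec (dim_col A) \<and> vec_norm2 v = 1}"
  have d: "dim_col A = n" using assms(1) by (auto simp: hermitian_mat_def)
  \<comment> \<open>Any common bound on the eigenvalues would do; it only shows that the supremum is
    taken over a bounded set.\<close>
  let ?w = "\<Sum>i<n. \<bar>eig A i\<bar>"
  have "\<bar>eig A i\<bar> \<le> ?w" if "i < n" for i
    using that by (intro member_le_sum) auto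
  then have "vec_norm2 (A *\<^sub>v v) \<le> ?w" if "v \<in> carrier_vec n" "vec_norm2 v = 1" for v
    using hermitian_norm_le[OF assms(1) that(1), of ?w] that(2) by (simp add: sum_nonneg)
  then have "bdd_above ?S" unfolding d by (intro bdd_aboveI[of _ ?w]) auto
  then show ?thesis unfolding spectral_norm_def using assms(2,3) d by (intro cSup_upper) auto
qed

lemma abs_eig_le_spectral_norm:
  assumes "hermitian_mat n A" "i < n"
  shows "\<bar>eig A i\<bar> \<le> spectral_norm A"
proof -
  obtain Q where Q: "unitary_mat n Q" "A = herm_fun n Q (eig A)"
    using hermitian_spectral[OF assms(1)] by blast
  have c: "col Q i \<in> carrier_vec n" using unitary_matD(1)[OF Q(1)] assms(2) by auto
  have "A *\<^sub>v col Q i = complex_of_real (eig A i) \<cdot>\<^sub>v col Q i"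
    using herm_fun_col[OF Q(1) assms(2), of "eig A"] Q(2) by simp
  then have "vec_norm2 (A *\<^sub>v col Q i) = \<bar>eig A i\<bar>"
    by (simp add: vec_norm2_smult vec_norm2_col_unitary[OF Q(1) assms(2)])
  then show ?thesis
    using spectral_norm_upper[OF assms(1) c vec_norm2_col_unitary[OF Q(1) assms(2)]] by simp
qed

lemma spectral_norm_le_iff:
  assumes "hermitian_mat n A" "1 \<le> n"
  shows "spectral_norm A \<le> w \<longleftrightarrow> (\<forall>i<n. \<bar>eig A i\<bar> \<le> w)"
proof
  assume "spectral_norm A \<le> w"
  then show "\<forall>i<n. \<bar>eig A i\<bar> \<le> w" using abs_eig_le_spectral_norm[OF assms(1)] by force
next
  assume w: "\<forall>i<n. \<bar>eig A i\<bar> \<le> w"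
  then have w0: "0 \<le> w" using assms(2) by (metis abs_ge_zero less_eq_Suc_le One_nat_def order_trans)
  have d: "dim_col A = n" using assms(1) by (auto simp: hermitian_mat_def)
  show "spectral_norm A \<le> w" unfolding spectral_norm_def d
  proof (rule cSup_least)
    \<comment> \<open>\<open>1 \<le> n\<close> provides a vector of norm 1; the supremum of the
      empty set could not be estimated.\<close>
    show "{vec_norm2 (A *\<^sub>v v) |v. v \<in> carrier_vec n \<and> vec_norm2 v = 1} \<noteq> {}"
      using vec_norm2_unit_vec[of 0 n] assms(2) unit_vec_carrier[of n 0] by (auto simp del: unit_vec_carrier)
  qed (use hermitian_norm_le[OF assms(1) _ w0] w in force)
qed

lemma spectral_norm_nonneg:
  assumes "hermitian_mat n A" "1 \<le> n"
  shows "0 \<le> spectral_norm A"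
  using abs_eig_le_spectral_norm[OF assms(1), of 0] assms(2) by simp

lemma spectral_norm_bound:
  assumes "hermitian_mat n A" "1 \<le> n" "v \<in> carrier_vec n"
  shows "vec_norm2 (A *\<^sub>v v) \<le> spectral_norm A * vec_norm2 v"
  using hermitian_norm_le[OF assms(1,3)] spectral_norm_nonneg[OF assms(1,2)]
    abs_eig_le_spectral_norm[OF assms(1)] by blast

text \<open>At a normalized eigenvector the quadratic form equals the eigenvalue, and the largest
  modulus of an eigenvalue is the norm. The separating functional delivers its bound in exactly this
  form.\<close>

lemma spectral_norm_le_quadratic_form:
  assumes "hermitian_mat n A" "1 \<le> n"
    and "\<And>v. v \<in> carrier_vec n \<Longrightarrow> vec_norm2 v = 1 \<Longrightarrow> \<bar>Re ((A *\<^sub>v v) \<bullet>c v)\<bar> \<le> w"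
  shows "spectral_norm A \<le> w"
  unfolding spectral_norm_le_iff[OF assms(1,2)]
proof (intro allI impI)
  fix i assume i: "i < n"
  obtain Q where Q: "unitary_mat n Q" "A = herm_fun n Q (eig A)"
    using hermitian_spectral[OF assms(1)] by blast
  have c: "col Q i \<in> carrier_vec n" using unitary_matD(1)[OF Q(1)] i by auto
  have e: "A *\<^sub>v col Q i = complex_of_real (eig A i) \<cdot>\<^sub>v col Q i"
    using herm_fun_col[OF Q(1) i, of "eig A"] Q(2) by simp
  have "(A *\<^sub>v col Q i) \<bullet>c col Q i = complex_of_real (eig A i)"
    unfolding e using c col_unitary_orthonormal[OF Q(1) i i]
    by (simp add: smult_scalar_prod_distrib[of _ n])
  then show "\<bar>eig A i\<bar> \<le> w"
    using assms(3)[OF c vec_norm2_col_unitary[OF Q(1) i]] by simp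
qed

lemma herm_fun_zero:
  assumes "unitary_mat n Q" "\<And>i. i < n \<Longrightarrow> d i = 0"
  shows "herm_fun n Q d = 0\<^sub>m n n"
proof -
  have "mat_diag n (\<lambda>i. complex_of_real (d i)) = 0\<^sub>m n n"
    using assms(2) by (intro eq_matI) (auto simp: mat_diag_def)
  then show ?thesis using unitary_matD(1)[OF assms(1)]
    by (simp add: herm_fun_def right_mult_zero_mat[of _ n] left_mult_zero_mat[of _ _ n])
qed

lemma spectral_norm_eq_0:
  assumes "hermitian_mat n A" "spectral_norm A = 0"
  shows "A = 0\<^sub>m n n"
  using hermitian_spectral[OF assms(1)] herm_fun_zero abs_eig_le_spectral_norm[OF assms(1)] assms(2)
  by (metis abs_le_zero_iff)

text \<open>Turns the matrix equations of a certificate into statements about eigenvalues. In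
  eigenbasis coordinates, multiplying row \<open>i\<close> of Q^* P by \<open>eig A i\<close> or by
  \<open>a\<close> gives the same result, so the row vanishes unless the two numbers agree.\<close>

lemma eig_of_eigenmatrix:
  assumes "hermitian_mat n A" "P \<in> carrier_mat n n" "P \<noteq> 0\<^sub>m n n"
    and "A * P = complex_of_real a \<cdot>\<^sub>m P"
  shows "\<exists>i<n. eig A i = a"
proof (rule ccontr)
  assume *: "\<not> (\<exists>i<n. eig A i = a)"
  obtain Q where uQ: "unitary_mat n Q" and A: "A = herm_fun n Q (eig A)"
    using hermitian_spectral[OF assms(1)] by blast
  note Q = unitary_matD[OF uQ]
  let ?R = "mat_adjoint Q * P"
  let ?D = "mat_diag n (\<lambda>i. complex_of_real (eig A i))"
  have "mat_adjoint Q * (A * P) = (mat_adjoint Q * Q) * ?D * ?R"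
    by (subst A) (use Q(1) assms(2) in \<open>simp add: herm_fun_def assoc_mult_mat[of _ n n _ n _ n]\<close>)
  then have "?D * ?R = mat_adjoint Q * (A * P)" using Q(2) Q(1) by simp
  also have "\<dots> = complex_of_real a \<cdot>\<^sub>m ?R"
    unfolding assms(4) using Q(1) assms(2) by (simp add: mult_smult_distrib[of _ n n])
  finally have DR: "?D * ?R = complex_of_real a \<cdot>\<^sub>m ?R" .
  have R: "?R \<in> carrier_mat n n" using Q(1) assms(2) by simp
  have "?R = 0\<^sub>m n n"
  proof (rule eq_matI)
    fix i j assume "i < dim_row (0\<^sub>m n n :: complex mat)" "j < dim_col (0\<^sub>m n n :: complex mat)"
    then have ij: "i < n" "j < n" by auto
    have "(?D * ?R) $$ (i, j) = complex_of_real (eig A i) * ?R $$ (i, j)"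
      unfolding mat_diag_mult_left[OF R] using ij by simp
    moreover have "(complex_of_real a \<cdot>\<^sub>m ?R) $$ (i, j) = complex_of_real a * ?R $$ (i, j)"
      using ij R by (simp del: index_mult_mat)
    ultimately have "complex_of_real (eig A i) * ?R $$ (i, j) = complex_of_real a * ?R $$ (i, j)"
      using DR by metis
    then have "?R $$ (i, j) = 0" using * ij by (metis mult_right_cancel of_real_eq_iff)
    then show "?R $$ (i, j) = 0\<^sub>m n n $$ (i, j)" using ij by simp
  qed (use R in auto)
  then have "Q * ?R = 0\<^sub>m n n" using Q(1) by (simp add: right_mult_zero_mat[of _ n])
  moreover have "Q * ?R = (Q * mat_adjoint Q) * P"
    using Q(1) assms(2) by (simp add: assoc_mult_mat[of _ n n _ n _ n])
  ultimately show False using Q(3) assms(2,3) by simp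
qed

text \<open>The eigenvalues decrease and stay between the two extreme values, so an extreme value
  taken anywhere is taken at the corresponding end.\<close>

lemma extreme_eig_eq_spectral_norm:
  assumes "hermitian_mat n A" "i < n"
  shows "eig A i = spectral_norm A \<Longrightarrow> eig A 0 = spectral_norm A"
    and "eig A i = - spectral_norm A \<Longrightarrow> eig A (n - 1) = - spectral_norm A"
proof -
  have "i \<le> n - 1" "n - 1 < n" using assms(2) by auto
  then show "eig A i = spectral_norm A \<Longrightarrow> eig A 0 = spectral_norm A"
    and "eig A i = - spectral_norm A \<Longrightarrow> eig A (n - 1) = - spectral_norm A"
    using eig_antimono[OF assms(1), of 0 i] eig_antimono[OF assms(1), of i "n - 1"] assms(2)
      abs_eig_le_spectral_norm[OF assms(1), of 0] abs_eig_le_spectral_norm[OF assms(1), of "n - 1"]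
    by linarith+
qed

subsection \<open>Spectral projections\<close>

lemma mat_eqI_mult_vec:
  assumes "A \<in> carrier_mat n n" "B \<in> carrier_mat n n"
    and "\<And>v. v \<in> carrier_vec n \<Longrightarrow> A *\<^sub>v v = B *\<^sub>v v"
  shows "A = (B :: 'a :: semiring_1 mat)"
proof (rule eq_matI)
  fix i j assume ij: "i < dim_row B" "j < dim_col B"
  have "(A *\<^sub>v unit_vec n j) $ i = (B *\<^sub>v unit_vec n j) $ i" using assms(3) by simp
  then show "A $$ (i, j) = B $$ (i, j)" using assms(1,2) ij by simp
qed (use assms in auto)

text \<open>The definite description requires uniqueness. Two self-adjoint projections with the same
  fixed vectors absorb each other, P R = R and R P = P, and taking the adjoint of the first equation
  gives R = R P = P.\<close>

lemma spectral_proj_herm_fun: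
  fixes a :: real
  assumes uQ: "unitary_mat n Q" and AQ: "A = herm_fun n Q d"
  defines "E \<equiv> herm_fun n Q (\<lambda>i. if d i = a then 1 else 0)"
  shows "spectral_proj A a = E"
    and "v \<in> carrier_vec n \<Longrightarrow> E *\<^sub>v v = v \<longleftrightarrow> A *\<^sub>v v = complex_of_real a \<cdot>\<^sub>v v"
proof -
  note Q = unitary_matD[OF uQ]
  have dA: "dim_row A = n" using Q(1) by (simp add: AQ carrier_matD[OF herm_fun_carrier])
  define e where "e i = (if d i = a then 1 else 0 :: real)" for i
  have E_def: "E = herm_fun n Q e" unfolding E_def e_def ..
  define pr where "pr P \<longleftrightarrow> hermitian_mat n P \<and> P * P = P \<and>
     (\<forall>v\<in>carrier_vec n. P *\<^sub>v v = v \<longleftrightarrow> A *\<^sub>v v = complex_of_real a \<cdot>\<^sub>v v)" for P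
  have hE: "hermitian_mat n E" unfolding E_def by (rule hermitian_herm_fun[OF Q(1)])
  have EE: "E * E = E" unfolding E_def herm_fun_mult[OF uQ]
    by (rule herm_fun_cong) (simp add: e_def)
  have fixE: "E *\<^sub>v v = v \<longleftrightarrow> A *\<^sub>v v = complex_of_real a \<cdot>\<^sub>v v" if v: "v \<in> carrier_vec n" for v
  proof -
    define w where "w = mat_adjoint Q *\<^sub>v v"
    have w: "w \<in> carrier_vec n" using v Q(1) by (simp add: w_def)
    have vw: "v = Q *\<^sub>v w" unfolding w_def using v Q
      by (simp add: assoc_mult_mat_vec[of _ n n _ n, symmetric])
    have hf: "herm_fun n Q d *\<^sub>v v = Q *\<^sub>v vec n (\<lambda>i. complex_of_real (d i) * w $ i)" for d
      unfolding mat_diag_mult_vec[OF w, symmetric] using Q(1) v w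
      by (simp add: herm_fun_def w_def assoc_mult_mat_vec[of _ n n _ n])
    have inj: "Q *\<^sub>v x = Q *\<^sub>v y \<longleftrightarrow> x = y" if "x \<in> carrier_vec n" "y \<in> carrier_vec n" for x y
    proof
      assume "Q *\<^sub>v x = Q *\<^sub>v y"
      then have "(mat_adjoint Q * Q) *\<^sub>v x = (mat_adjoint Q * Q) *\<^sub>v y"
        using Q(1) that by (simp add: assoc_mult_mat_vec[of _ n n _ n])
      then show "x = y" using Q(2) that by simp
    qed simp
    have "E *\<^sub>v v = v \<longleftrightarrow> vec n (\<lambda>i. complex_of_real (e i) * w $ i) = w"
      unfolding E_def hf by (subst vw, subst inj) (use w in auto)
    also have "\<dots> \<longleftrightarrow> (\<forall>i<n. complex_of_real (e i) * w $ i = w $ i)"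
      using w by (auto simp: vec_eq_iff)
    \<comment> \<open>Both sides say that \<open>w\<close> vanishes at every index with
      \<open>d i \<noteq> a\<close>.\<close>
    also have "\<dots> \<longleftrightarrow> (\<forall>i<n. complex_of_real (d i) * w $ i = complex_of_real a * w $ i)"
      by (auto simp: e_def)
    also have "\<dots> \<longleftrightarrow> vec n (\<lambda>i. complex_of_real (d i) * w $ i) = complex_of_real a \<cdot>\<^sub>v w"
      using w by (auto simp: vec_eq_iff)
    also have "\<dots> \<longleftrightarrow> Q *\<^sub>v vec n (\<lambda>i. complex_of_real (d i) * w $ i) = Q *\<^sub>v (complex_of_real a \<cdot>\<^sub>v w)"
      by (subst inj) (use w in auto)
    also have "Q *\<^sub>v (complex_of_real a \<cdot>\<^sub>v w) = complex_of_real a \<cdot>\<^sub>v v"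
      using Q(1) w by (simp add: mult_mat_vec[of _ n n] vw[symmetric])
    also have "Q *\<^sub>v vec n (\<lambda>i. complex_of_real (d i) * w $ i) = A *\<^sub>v v"
      unfolding AQ by (rule hf[symmetric])
    finally show ?thesis .
  qed
  \<comment> \<open>Every vector in the range of \<open>R\<close> is fixed by \<open>R\<close>,
    hence lies in the eigenspace, hence is fixed by \<open>P\<close>.\<close>
  have absorb: "P * R = R" if "pr P" "pr R" for P R
  proof (rule mat_eqI_mult_vec[of _ n])
    from that have c: "P \<in> carrier_mat n n" "R \<in> carrier_mat n n"
      by (auto simp: pr_def hermitian_mat_def)
    then show "P * R \<in> carrier_mat n n" "R \<in> carrier_mat n n" by auto
    fix v :: "complex vec" assume v: "v \<in> carrier_vec n"
    then have Rv: "R *\<^sub>v v \<in> carrier_vec n" using c by simp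
    have "R *\<^sub>v (R *\<^sub>v v) = R *\<^sub>v v"
      using that(2) c v by (simp add: pr_def assoc_mult_mat_vec[of _ n n _ n, symmetric])
    then have "P *\<^sub>v (R *\<^sub>v v) = R *\<^sub>v v"
      using that Rv unfolding pr_def by metis
    then show "P * R *\<^sub>v v = R *\<^sub>v v" using c v by (simp add: assoc_mult_mat_vec[of _ n n _ n])
  qed
  have "R = P" if "pr P" "pr R" for P R
  proof -
    have c: "P \<in> carrier_mat n n" "R \<in> carrier_mat n n" "mat_adjoint P = P" "mat_adjoint R = R"
      using that by (auto simp: pr_def hermitian_mat_def)
    have "R = mat_adjoint (P * R)" using absorb[OF that] c by simp
    also have "\<dots> = R * P" using c by (simp add: mat_adjoint_mult[of _ n n _ n])
    finally show ?thesis using absorb[OF that(2,1)] by simp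
  qed
  moreover have "pr E" using hE EE fixE by (simp add: pr_def)
  ultimately have "spectral_proj A a = E"
    unfolding spectral_proj_def dA pr_def[symmetric] by (intro the_equality)
  then show "spectral_proj A a = E" .
  show "v \<in> carrier_vec n \<Longrightarrow> E *\<^sub>v v = v \<longleftrightarrow> A *\<^sub>v v = complex_of_real a \<cdot>\<^sub>v v"
    by (rule fixE)
qed

text \<open>The range of \<open>Z\<close> lies in the eigenspace. This gives the projection clauses
  of d) and lets certificates be compressed to eigenspaces.\<close>

lemma spectral_proj_mult_eigenmatrix:
  assumes "hermitian_mat n A" "Z \<in> carrier_mat n n" "A * Z = complex_of_real a \<cdot>\<^sub>m Z"
  shows "spectral_proj A a * Z = Z"
proof (rule mat_eqI_mult_vec[of _ n])
  have A: "A \<in> carrier_mat n n" using assms(1) by (simp add: hermitian_mat_def)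
  obtain Q where Q: "unitary_mat n Q" "A = herm_fun n Q (eig A)"
    using hermitian_spectral[OF assms(1)] by blast
  have E: "spectral_proj A a \<in> carrier_mat n n"
    "v \<in> carrier_vec n \<Longrightarrow> A *\<^sub>v v = complex_of_real a \<cdot>\<^sub>v v \<Longrightarrow> spectral_proj A a *\<^sub>v v = v" for v
    using spectral_proj_herm_fun[OF Q, where a = a] unitary_matD(1)[OF Q(1)] by auto
  show "spectral_proj A a * Z \<in> carrier_mat n n" using E(1) assms(2) by simp
  fix v :: "complex vec" assume v: "v \<in> carrier_vec n"
  have "A *\<^sub>v (Z *\<^sub>v v) = (complex_of_real a \<cdot>\<^sub>m Z) *\<^sub>v v"
    using A assms(2) v by (simp add: assoc_mult_mat_vec[of _ n n _ n, symmetric] assms(3))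
  also have "\<dots> = complex_of_real a \<cdot>\<^sub>v (Z *\<^sub>v v)"
    using assms(2) v by (intro eq_vecI) (auto simp: scalar_prod_def sum_distrib_left mult.assoc)
  finally have "spectral_proj A a *\<^sub>v (Z *\<^sub>v v) = Z *\<^sub>v v"
    using E(2) assms(2) v by simp
  then show "spectral_proj A a * Z *\<^sub>v v = Z *\<^sub>v v"
    using E(1) assms(2) v by (simp add: assoc_mult_mat_vec[of _ n n _ n])
qed (rule assms(2))

subsection \<open>Positive semidefinite matrices and the trace norm\<close>

lemma psd_mat_carrier [simp]: "psd_mat n P \<Longrightarrow> P \<in> carrier_mat n n"
  by (simp add: psd_mat_def hermitian_mat_def)

lemma psd_diagonalization:
  assumes "psd_mat n P"
  obtains Q d where "unitary_mat n Q" "P = herm_fun n Q d" "\<And>i. i < n \<Longrightarrow> 0 \<le> d i"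
proof -
  obtain Q where Q: "unitary_mat n Q" "P = herm_fun n Q (eig P)"
    using hermitian_spectral assms unfolding psd_mat_def by blast
  then have "0 \<le> eig P i" if "i < n" for i
    using psd_herm_fun_nonneg[OF Q(1) _ that] assms by metis
  with Q that show ?thesis by blast
qed

lemma psd_sqrt_exists:
  assumes "psd_mat n P"
  shows "\<exists>S. psd_mat n S \<and> S * S = P"
proof -
  obtain Q d where Q: "unitary_mat n Q" "P = herm_fun n Q d" "\<And>i. i < n \<Longrightarrow> 0 \<le> d i"
    using psd_diagonalization[OF assms] by blast
  have "herm_fun n Q (\<lambda>i. sqrt (d i)) * herm_fun n Q (\<lambda>i. sqrt (d i)) = P"
    unfolding Q(2) herm_fun_mult[OF Q(1)] by (rule herm_fun_cong) (simp add: Q(3))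
  moreover have "psd_mat n (herm_fun n Q (\<lambda>i. sqrt (d i)))"
    by (rule psd_herm_fun[OF Q(1)]) (simp add: Q(3))
  ultimately show ?thesis by blast
qed

lemma psd_adjoint_mult:
  assumes "B \<in> carrier_mat m n"
  shows "psd_mat n (mat_adjoint B * B)"
  unfolding psd_mat_def hermitian_mat_def
proof (intro conjI ballI)
  show "mat_adjoint B * B \<in> carrier_mat n n" using assms by auto
  show "mat_adjoint (mat_adjoint B * B) = mat_adjoint B * B"
    using assms by (simp add: mat_adjoint_mult[of _ n m _ n])
  fix v :: "complex vec" assume v: "v \<in> carrier_vec n"
  have Bv: "B *\<^sub>v v \<in> carrier_vec m" using assms v by auto
  have "(mat_adjoint B * B *\<^sub>v v) \<bullet>c v = (mat_adjoint B *\<^sub>v (B *\<^sub>v v)) \<bullet>c v"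
    using assms v by (simp add: assoc_mult_mat_vec[of _ n m _ n])
  also have "\<dots> = (B *\<^sub>v v) \<bullet>c (B *\<^sub>v v)"
    using assms v Bv by (simp add: cscalar_prod_mat_adjoint[of _ n m])
  finally show "0 \<le> Re ((mat_adjoint B * B *\<^sub>v v) \<bullet>c v)"
    by (simp add: cscalar_prod_norm[OF Bv] del: of_real_power)
qed

lemma psd_mult_adjoint: "B \<in> carrier_mat n m \<Longrightarrow> psd_mat n (B * mat_adjoint B)"
  using psd_adjoint_mult[of "mat_adjoint B" m n] by simp

lemma psd_conj:
  assumes "psd_mat n P" "S \<in> carrier_mat n k"
  shows "psd_mat k (mat_adjoint S * P * S)"
proof -
  obtain R where R: "psd_mat n R" "R * R = P" using psd_sqrt_exists[OF assms(1)] by blast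
  have adjR: "mat_adjoint R = R" using R(1) by (simp add: psd_mat_def hermitian_mat_def)
  have Rc: "R \<in> carrier_mat n n" using R(1) by simp
  have RS: "R * S \<in> carrier_mat n k" using Rc assms(2) by (rule mult_carrier_mat)
  have "mat_adjoint (R * S) * (R * S) = mat_adjoint S * R * (R * S)"
    using Rc assms(2) by (simp add: mat_adjoint_mult[of _ n n _ k] adjR)
  also have "\<dots> = mat_adjoint S * (R * R) * S"
    using Rc assms(2) RS by (simp add: assoc_mult_mat[of _ k n _ n _ k] assoc_mult_mat[of _ n n _ n _ k])
  finally show ?thesis using psd_adjoint_mult[OF RS] R(2) by simp
qed

lemma psd_add:
  assumes "psd_mat n P" "psd_mat n N"
  shows "psd_mat n (P + N)"
  using assms
  by (auto simp: psd_mat_def hermitian_mat_def mat_adjoint_add[of _ n n] add_mult_distrib_mat_vec[of _ n n]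
      add_scalar_prod_distrib[of _ n])

lemma psd_smult:
  assumes "psd_mat n P" "0 \<le> c"
  shows "psd_mat n (complex_of_real c \<cdot>\<^sub>m P)"
proof -
  have P: "P \<in> carrier_mat n n" using assms(1) by simp
  have "mat_adjoint (complex_of_real c \<cdot>\<^sub>m P) = complex_of_real c \<cdot>\<^sub>m mat_adjoint P"
    by (intro eq_matI) auto
  moreover have "(complex_of_real c \<cdot>\<^sub>m P) *\<^sub>v v = complex_of_real c \<cdot>\<^sub>v (P *\<^sub>v v)"
    if "v \<in> carrier_vec n" for v
    using P that by (intro eq_vecI) (auto simp: scalar_prod_def sum_distrib_left mult.assoc)
  ultimately show ?thesis
    using assms P by (auto simp: psd_mat_def hermitian_mat_def smult_scalar_prod_distrib[of _ n])
qed

text \<open>Makes \<open>mat_abs\<close> well defined. If P q = d q, then R R q = d^2 q, so u = R q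
  - d q satisfies R u = - d u, and positivity of \<open>R\<close> forces u = 0 when d > 0. When d =
  0, u = R q and its squared norm is the inner product of q with R R q = 0. Thus \<open>R\<close>
  and \<open>P\<close> agree on an eigenbasis of \<open>P\<close>.\<close>

lemma psd_sqrt_unique:
  assumes "psd_mat n P" "psd_mat n R" "P * P = R * R"
  shows "R = P"
proof -
  obtain Q d where uQ: "unitary_mat n Q" and P: "P = herm_fun n Q d" and d: "\<And>i. i < n \<Longrightarrow> 0 \<le> d i"
    using psd_diagonalization[OF assms(1)] by blast
  note Q = unitary_matD[OF uQ]
  have R: "R \<in> carrier_mat n n" and adjR: "mat_adjoint R = R"
    using assms(2) by (auto simp: psd_mat_def hermitian_mat_def)
  have "R *\<^sub>v col Q i = complex_of_real (d i) \<cdot>\<^sub>v col Q i" if i: "i < n" for i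
  proof -
    let ?q = "col Q i"
    have q: "?q \<in> carrier_vec n" using Q(1) i by auto
    define u where "u = R *\<^sub>v ?q - complex_of_real (d i) \<cdot>\<^sub>v ?q"
    have Rq: "R *\<^sub>v ?q \<in> carrier_vec n" using R q by simp
    have u: "u \<in> carrier_vec n" using Rq q by (simp add: u_def)
    have "R *\<^sub>v (R *\<^sub>v ?q) = (P * P) *\<^sub>v ?q"
      using R q by (simp add: assms(3) assoc_mult_mat_vec[of _ n n _ n])
    also have "\<dots> = complex_of_real (d i * d i) \<cdot>\<^sub>v ?q"
      unfolding P herm_fun_mult[OF uQ] by (rule herm_fun_col[OF uQ i])
    finally have RRq: "R *\<^sub>v (R *\<^sub>v ?q) = complex_of_real (d i * d i) \<cdot>\<^sub>v ?q" .
    have Ru: "R *\<^sub>v u = - complex_of_real (d i) \<cdot>\<^sub>v u"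
      using R Rq q Q(1) unfolding u_def
      by (simp add: mult_minus_distrib_mat_vec[of _ n n] mult_mat_vec[of _ n n] RRq)
         (intro eq_vecI, auto simp: algebra_simps)
    have "0 \<le> Re ((R *\<^sub>v u) \<bullet>c u)" using assms(2) u by (simp add: psd_mat_def)
    also have "(R *\<^sub>v u) \<bullet>c u = complex_of_real (- d i * (vec_norm2 u)\<^sup>2)"
      unfolding Ru using u by (simp add: cscalar_prod_norm)
    finally have "d i * (vec_norm2 u)\<^sup>2 \<le> 0" by simp
    then have "d i = 0 \<or> vec_norm2 u = 0"
      using d[OF i] by (metis antisym mult_eq_0_iff mult_nonneg_nonneg power2_eq_square zero_le_power2)
    moreover have "vec_norm2 u = 0" if "d i = 0"
    proof -
      have "u = R *\<^sub>v ?q" using that R Q(1) by (intro eq_vecI) (auto simp: u_def)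
      then have "u \<bullet>c u = ?q \<bullet>c (R *\<^sub>v (R *\<^sub>v ?q))"
        using R q Rq adjR cscalar_prod_mat_adjoint[OF R q Rq] by simp
      also have "\<dots> = 0" unfolding RRq that using q Q(1) by (simp add: cscalar_prod_sum[of _ n])
      finally show ?thesis by (simp add: vec_norm2_def)
    qed
    ultimately have "vec_norm2 u = 0" by blast
    then have "(\<Sum>i<n. (cmod (u $ i))\<^sup>2) = 0" using vec_norm2_sq[OF u] by simp
    then have "u $ k = 0" if "k < n" for k using that by (simp add: sum_nonneg_eq_0_iff)
    then show ?thesis using R Q(1) unfolding u_def by (intro eq_vecI) auto
  qed
  then have "R * Q = Q * mat_diag n (\<lambda>i. complex_of_real (d i))"
  proof (intro eq_matI)
    fix i j assume "i < dim_row (Q * mat_diag n (\<lambda>i. complex_of_real (d i)))"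
      "j < dim_col (Q * mat_diag n (\<lambda>i. complex_of_real (d i)))"
    then have ij: "i < n" "j < n" using Q(1) by (auto simp: mat_diag_def)
    assume *: "\<And>i. i < n \<Longrightarrow> R *\<^sub>v col Q i = complex_of_real (d i) \<cdot>\<^sub>v col Q i"
    have "(R * Q) $$ (i, j) = (R *\<^sub>v col Q j) $ i" using R Q(1) ij by simp
    also have "\<dots> = complex_of_real (d j) * Q $$ (i, j)" unfolding *[OF ij(2)] using Q(1) ij by simp
    finally show "(R * Q) $$ (i, j) = (Q * mat_diag n (\<lambda>i. complex_of_real (d i))) $$ (i, j)"
      unfolding mat_diag_mult_right[OF Q(1)] using ij by simp
  qed (use R Q(1) in \<open>auto simp: mat_diag_def\<close>)
  from herm_funI[OF uQ R this] show ?thesis using P by simp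
qed

lemma mat_abs_eqI:
  assumes "X \<in> carrier_mat n n" "psd_mat n P" "P * P = mat_adjoint X * X"
  shows "mat_abs X = P"
  unfolding mat_abs_def
proof (rule the_equality)
  show "psd_mat (dim_col X) P \<and> P * P = mat_adjoint X * X" using assms by auto
  show "R = P" if "psd_mat (dim_col X) R \<and> R * R = mat_adjoint X * X" for R
    using that assms psd_sqrt_unique[of n P R] by simp
qed

lemma mat_abs_props:
  assumes "X \<in> carrier_mat n n"
  shows "psd_mat n (mat_abs X)" "mat_abs X * mat_abs X = mat_adjoint X * X"
  using psd_sqrt_exists[OF psd_adjoint_mult[OF assms]] mat_abs_eqI[OF assms] by metis+

section \<open>Traces and trace duality\<close>

lemma mat_trace_add:
  "A \<in> carrier_mat n n \<Longrightarrow> B \<in> carrier_mat n n \<Longrightarrow> mat_trace (A + B) = mat_trace A + mat_trace B"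
  by (auto simp: mat_trace_def sum.distrib)

lemma mat_trace_minus:
  "A \<in> carrier_mat n n \<Longrightarrow> B \<in> carrier_mat n n \<Longrightarrow> mat_trace (A - B) = mat_trace A - mat_trace B"
  by (auto simp: mat_trace_def sum_subtractf)

lemma mat_trace_smult: "A \<in> carrier_mat n n \<Longrightarrow> mat_trace (c \<cdot>\<^sub>m A) = c * mat_trace A"
  by (auto simp: mat_trace_def sum_distrib_left)

lemma mat_trace_mult:
  assumes "A \<in> carrier_mat n m" "B \<in> carrier_mat m n"
  shows "mat_trace (A * B) = (\<Sum>i<n. \<Sum>k<m. A $$ (i, k) * B $$ (k, i))"
proof -
  have "dim_row (A * B) = n" using assms by simp
  then show ?thesis unfolding mat_trace_def
    by (intro sum.cong) (auto simp: index_mult_mat_sum[OF assms] simp del: index_mult_mat(1))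
qed

lemma mat_trace_comm:
  assumes "A \<in> carrier_mat n m" "B \<in> carrier_mat m n"
  shows "mat_trace (A * B) = mat_trace (B * A)"
  unfolding mat_trace_mult[OF assms] mat_trace_mult[OF assms(2,1)]
  by (subst sum.swap) (simp add: mult.commute)

lemma mat_trace_herm_fun:
  assumes "unitary_mat n Q"
  shows "mat_trace (herm_fun n Q d) = complex_of_real (\<Sum>i<n. d i)"
proof -
  note Q = unitary_matD[OF assms]
  let ?D = "mat_diag n (\<lambda>i. complex_of_real (d i))"
  have "mat_trace (herm_fun n Q d) = mat_trace (mat_adjoint Q * (Q * ?D))"
    unfolding herm_fun_def using Q(1) by (intro mat_trace_comm[of _ n n]) auto
  also have "mat_adjoint Q * (Q * ?D) = ?D"
    using Q by (simp add: assoc_mult_mat[of _ n n _ n _ n, symmetric])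
  finally show ?thesis by (simp add: mat_trace_def mat_diag_def)
qed

lemma mat_trace_psd:
  assumes "psd_mat n P"
  shows "mat_trace P = complex_of_real (Re (mat_trace P))" "0 \<le> Re (mat_trace P)"
    "Re (mat_trace P) = 0 \<Longrightarrow> P = 0\<^sub>m n n"
proof -
  obtain Q d where Q: "unitary_mat n Q" "P = herm_fun n Q d" and d: "\<And>i. i < n \<Longrightarrow> 0 \<le> d i"
    using psd_diagonalization[OF assms] by blast
  have t: "mat_trace P = complex_of_real (\<Sum>i<n. d i)" unfolding Q(2) by (rule mat_trace_herm_fun[OF Q(1)])
  then show "mat_trace P = complex_of_real (Re (mat_trace P))" by simp
  show "0 \<le> Re (mat_trace P)" unfolding t using d by (auto intro!: sum_nonneg)
  assume "Re (mat_trace P) = 0"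
  then have "(\<Sum>i<n. d i) = 0" unfolding t by simp
  then have "d i = 0" if "i < n" for i
    using d that by (subst (asm) sum_nonneg_eq_0_iff) auto
  then show "P = 0\<^sub>m n n" unfolding Q(2) by (rule herm_fun_zero[OF Q(1)])
qed

text \<open>The diagonal entries of B^* B are the squared norms of the columns of
  \<open>B\<close>.\<close>

lemma adjoint_mult_self_eq_0:
  fixes B :: "complex mat"
  assumes "B \<in> carrier_mat n m" "mat_adjoint B * B = 0\<^sub>m m m"
  shows "B = 0\<^sub>m n m"
proof (rule eq_matI)
  fix i j assume "i < dim_row (0\<^sub>m n m :: complex mat)" "j < dim_col (0\<^sub>m n m :: complex mat)"
  then have ij: "i < n" "j < m" by auto
  have "(mat_adjoint B * B) $$ (j, j) = (\<Sum>k<n. cnj (B $$ (k, j)) * B $$ (k, j))"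
    using assms(1) ij by (subst index_mult_mat_sum[of _ m n _ m]) auto
  also have "\<dots> = complex_of_real (\<Sum>k<n. (cmod (B $$ (k, j)))\<^sup>2)"
    by (simp add: complex_norm_square mult.commute del: of_real_power)
  finally have "(\<Sum>k<n. (cmod (B $$ (k, j)))\<^sup>2) = 0" using assms(2) ij by (metis index_zero_mat(1) of_real_eq_0_iff)
  then show "B $$ (i, j) = 0\<^sub>m n m $$ (i, j)" using ij by (simp add: sum_nonneg_eq_0_iff)
qed (use assms in auto)

lemma mat_trace_conj_unitary:
  assumes "unitary_mat n Q" "M \<in> carrier_mat n n"
  shows "mat_trace M = (\<Sum>i<n. (M *\<^sub>v col Q i) \<bullet>c col Q i)"
proof -
  note Q = unitary_matD[OF assms(1)]
  have "mat_trace M = mat_trace (M * Q * mat_adjoint Q)"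
    using Q assms(2) by (simp add: assoc_mult_mat[of _ n n _ n _ n])
  also have "\<dots> = mat_trace (mat_adjoint Q * (M * Q))"
    using Q(1) assms(2) by (intro mat_trace_comm[of _ n n]) auto
  also have "\<dots> = (\<Sum>i<n. \<Sum>k<n. mat_adjoint Q $$ (i, k) * (M * Q) $$ (k, i))"
    using Q(1) assms(2) by (intro mat_trace_mult) auto
  also have "\<dots> = (\<Sum>i<n. (M *\<^sub>v col Q i) \<bullet>c col Q i)"
    using Q(1) assms(2)
    by (intro sum.cong refl, subst cscalar_prod_sum[of _ n]) (auto simp: mult.commute intro!: sum.cong)
  finally show ?thesis .
qed

text \<open>Trace duality. The trace is evaluated in an eigenbasis of \<open>P\<close>: since P P =
  X^* X, the image of the i-th basis vector under \<open>X\<close> has norm \<open>d i\<close>, and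
  Cauchy-Schwarz bounds the i-th term by ||B|| \<open>d i\<close>. As \<open>P\<close> is given by
  its defining equation, it can be \<open>mat_abs X\<close>, or \<open>X\<close> itself when
  \<open>X\<close> is positive semidefinite.\<close>

lemma cmod_trace_mult_le:
  assumes B: "hermitian_mat n B" and n: "1 \<le> n" and w: "spectral_norm B \<le> w"
    and X: "X \<in> carrier_mat n n" and P: "psd_mat n P" and PX: "P * P = mat_adjoint X * X"
  shows "cmod (mat_trace (B * X)) \<le> w * Re (mat_trace P)"
proof -
  obtain Q d where uQ: "unitary_mat n Q" and Pd: "P = herm_fun n Q d" and d: "\<And>i. i < n \<Longrightarrow> 0 \<le> d i"
    using psd_diagonalization[OF P] by blast
  note Q = unitary_matD[OF uQ]
  have Bc: "B \<in> carrier_mat n n" using B by (simp add: hermitian_mat_def)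
  have "cmod (((B * X) *\<^sub>v col Q i) \<bullet>c col Q i) \<le> w * d i" if i: "i < n" for i
  proof -
    let ?q = "col Q i"
    have q: "?q \<in> carrier_vec n" using Q(1) i by auto
    have nq: "vec_norm2 ?q = 1" by (rule vec_norm2_col_unitary[OF uQ i])
    have Xq: "X *\<^sub>v ?q \<in> carrier_vec n" using X q by simp
    have "(X *\<^sub>v ?q) \<bullet>c (X *\<^sub>v ?q) = ?q \<bullet>c ((P * P) *\<^sub>v ?q)"
      using X q Xq by (simp add: cscalar_prod_mat_adjoint[of _ n n] PX assoc_mult_mat_vec[of _ n n _ n])
    also have "(P * P) *\<^sub>v ?q = complex_of_real (d i * d i) \<cdot>\<^sub>v ?q"
      unfolding Pd herm_fun_mult[OF uQ] by (rule herm_fun_col[OF uQ i])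
    also have "?q \<bullet>c (complex_of_real (d i * d i) \<cdot>\<^sub>v ?q) = complex_of_real (d i * d i) * (?q \<bullet>c ?q)"
      using q Q(1) by (simp add: cscalar_prod_sum[of _ n] sum_distrib_left mult_ac)
    finally have "(X *\<^sub>v ?q) \<bullet>c (X *\<^sub>v ?q) = complex_of_real (d i * d i)"
      using col_unitary_orthonormal[OF uQ i i] by simp
    then have nX: "vec_norm2 (X *\<^sub>v ?q) = d i" using d[OF i] by (simp add: vec_norm2_def)
    have "cmod (((B * X) *\<^sub>v ?q) \<bullet>c ?q) \<le> vec_norm2 ((B * X) *\<^sub>v ?q) * vec_norm2 ?q"
      using Bc X q by (intro cmod_cscalar_prod_le[of _ n]) auto
    also have "\<dots> = vec_norm2 (B *\<^sub>v (X *\<^sub>v ?q))"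
      using Bc X q nq by (simp add: assoc_mult_mat_vec[of _ n n _ n])
    also have "\<dots> \<le> spectral_norm B * d i" using spectral_norm_bound[OF B n Xq] nX by simp
    also have "\<dots> \<le> w * d i" using w d[OF i] by (intro mult_right_mono)
    finally show ?thesis .
  qed
  then have "(\<Sum>i<n. cmod (((B * X) *\<^sub>v col Q i) \<bullet>c col Q i)) \<le> (\<Sum>i<n. w * d i)"
    by (intro sum_mono) auto
  moreover have "cmod (mat_trace (B * X)) \<le> (\<Sum>i<n. cmod (((B * X) *\<^sub>v col Q i) \<bullet>c col Q i))"
    using Bc X by (subst mat_trace_conj_unitary[OF uQ]) (auto intro: norm_sum)
  moreover have "(\<Sum>i<n. w * d i) = w * Re (mat_trace P)"
    unfolding Pd mat_trace_herm_fun[OF uQ] by (simp add: sum_distrib_left)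
  ultimately show ?thesis by linarith
qed

text \<open>Complementary slackness. With square roots T and S, cyclicity makes the trace of M P the
  sum of the squared moduli of the entries of T S; so T S = 0, and M P = T (T S) S.\<close>

lemma psd_mult_eq_0:
  assumes "psd_mat n M" "psd_mat n P" "mat_trace (M * P) = 0"
  shows "M * P = 0\<^sub>m n n"
proof -
  obtain T where T: "psd_mat n T" "T * T = M" using psd_sqrt_exists[OF assms(1)] by blast
  obtain S where S: "psd_mat n S" "S * S = P" using psd_sqrt_exists[OF assms(2)] by blast
  have c: "T \<in> carrier_mat n n" "S \<in> carrier_mat n n" "mat_adjoint T = T" "mat_adjoint S = S"
    using T(1) S(1) by (auto simp: psd_mat_def hermitian_mat_def)
  let ?Y = "T * S"
  have Y: "?Y \<in> carrier_mat n n" using c by simp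
  have YY: "mat_adjoint ?Y * ?Y = S * (M * S)"
    using c by (simp add: mat_adjoint_mult[of _ n n _ n] T(2)[symmetric] assoc_mult_mat[of _ n n _ n _ n])
  have "mat_trace (S * (M * S)) = mat_trace (M * S * S)"
    using c T(2)[symmetric] by (intro mat_trace_comm[of _ n n]) auto
  also have "M * S * S = M * P"
    using c by (simp add: T(2)[symmetric] S(2)[symmetric] assoc_mult_mat[of _ n n _ n _ n])
  finally have "mat_adjoint ?Y * ?Y = 0\<^sub>m n n"
    using mat_trace_psd(3)[OF psd_adjoint_mult[OF Y]] YY assms(3) by simp
  then have Y0: "?Y = 0\<^sub>m n n" by (rule adjoint_mult_self_eq_0[OF Y])
  have "M * P = T * ?Y * S"
    using c by (simp add: T(2)[symmetric] S(2)[symmetric] assoc_mult_mat[of _ n n _ n _ n])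
  then show ?thesis unfolding Y0 using c
    by (simp add: right_mult_zero_mat[of _ n] left_mult_zero_mat[of _ _ n])
qed

text \<open>By cyclicity the trace is that of S M S for the square root S of \<open>P\<close>, and S
  M S is positive semidefinite.\<close>

lemma psd_mult_trace_nonneg:
  assumes "psd_mat n M" "psd_mat n P"
  shows "mat_trace (M * P) = complex_of_real (Re (mat_trace (M * P)))" "0 \<le> Re (mat_trace (M * P))"
proof -
  obtain S where S: "psd_mat n S" "S * S = P" using psd_sqrt_exists[OF assms(2)] by blast
  have c: "S \<in> carrier_mat n n" "mat_adjoint S = S" "M \<in> carrier_mat n n"
    using S(1) assms(1) by (auto simp: psd_mat_def hermitian_mat_def)
  have "mat_trace (M * P) = mat_trace (M * S * S)"
    using c by (simp add: S(2)[symmetric] assoc_mult_mat[of _ n n _ n _ n])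
  also have "\<dots> = mat_trace (S * (M * S))" using c by (intro mat_trace_comm[of _ n n]) auto
  also have "S * (M * S) = mat_adjoint S * M * S"
    using c by (simp add: assoc_mult_mat[of _ n n _ n _ n])
  finally have "mat_trace (M * P) = mat_trace (mat_adjoint S * M * S)" .
  with mat_trace_psd[OF psd_conj[OF assms(1) c(1)]]
  show "mat_trace (M * P) = complex_of_real (Re (mat_trace (M * P)))" "0 \<le> Re (mat_trace (M * P))"
    by simp_all
qed

subsection \<open>Existence of certificates\<close>

text \<open>The squared distance from the data of \<open>(P, N)\<close> to those of an optimal dual pair:
  equal diagonals and \<open>tr (A (P - N)) = m\<close>.\<close>

definition dual_gap :: "nat \<Rightarrow> complex mat \<Rightarrow> real \<Rightarrow> complex mat \<Rightarrow> complex mat \<Rightarrow> real" where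
  "dual_gap n A m P N = (\<Sum>k<n. (Re (P $$ (k, k)) - Re (N $$ (k, k)))\<^sup>2) +
     (Re (mat_trace (A * P)) - Re (mat_trace (A * N)) - m)\<^sup>2"

lemma compact_PiE_UNIV:
  fixes S :: "'b :: topological_space set"
  assumes "compact S"
  shows "compact (Pi\<^sub>E UNIV (\<lambda>_ :: 'a. S))"
proof -
  have "compactin (product_topology (\<lambda>_ :: 'a. euclidean) UNIV) (Pi\<^sub>E UNIV (\<lambda>_. S))"
    unfolding compactin_PiE using assms by simp
  then show ?thesis by (simp add: euclidean_product_topology)
qed

text \<open>The matrix entries in question have modulus at most 1, so any compact set containing the
  disc can confine them; a square is a product of two intervals.\<close>

lemma compact_superset_unit_disc:
  obtains S :: "complex set" where "compact S" "\<And>z. cmod z \<le> 1 \<Longrightarrow> z \<in> S"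
proof
  let ?h = "\<lambda>(a, b). Complex a b"
  show "compact (?h ` ({-1..1} \<times> {-1..1}))"
    by (intro compact_continuous_image compact_Times compact_Icc)
      (auto simp: case_prod_unfold complex_eq_iff Complex_eq intro!: continuous_intros)
  fix z :: complex assume "cmod z \<le> 1"
  then have "\<bar>Re z\<bar> \<le> 1" "\<bar>Im z\<bar> \<le> 1" using abs_Re_le_cmod abs_Im_le_cmod order_trans by blast+
  then show "z \<in> ?h ` ({-1..1} \<times> {-1..1})"
    by (intro image_eqI[of _ _ "(Re z, Im z)"]) auto
qed

lemma gram_index:
  assumes "k < n" "l < n"
  shows "(mat n n f * mat_adjoint (mat n n f)) $$ (k, l) = (\<Sum>j<n. f (k, j) * cnj (f (l, j)))"
  using assms by (subst index_mult_mat_sum[of _ n n _ n]) auto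

lemma mat_trace_gram:
  "mat_trace (mat n n f * mat_adjoint (mat n n f)) = complex_of_real (\<Sum>k<n. \<Sum>j<n. (cmod (f (k, j)))\<^sup>2)"
  unfolding mat_trace_def
  by (simp add: gram_index complex_norm_square del: of_real_power index_mult_mat(1))

text \<open>Writing P and N as Gram matrices absorbs the positivity constraint: the trace condition
  becomes the equation of a sphere in the entries, and the gap a polynomial. The entries are
  functions on index pairs, so Tychonoff's theorem gives compactness.\<close>

lemma exists_min_dual_gap:
  assumes A: "A \<in> carrier_mat n n" and n: "1 \<le> n"
  shows "\<exists>P N. psd_mat n P \<and> psd_mat n N \<and> mat_trace P + mat_trace N = 1 \<and>
    (\<forall>P' N'. psd_mat n P' \<longrightarrow> psd_mat n N' \<longrightarrow> mat_trace P' + mat_trace N' = 1 \<longrightarrow>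
      dual_gap n A m P N \<le> dual_gap n A m P' N')"
proof -
  obtain S :: "complex set" where S: "compact S" "\<And>z. cmod z \<le> 1 \<Longrightarrow> z \<in> S"
    using compact_superset_unit_disc by blast
  define G where "G f = mat n n f * mat_adjoint (mat n n f)" for f :: "nat \<times> nat \<Rightarrow> complex"
  define F where "F f = (\<Sum>k<n. \<Sum>j<n. (cmod (f (k, j)))\<^sup>2)" for f :: "nat \<times> nat \<Rightarrow> complex"
  define C where "C = Pi\<^sub>E UNIV (\<lambda>_ :: nat \<times> nat. S)"
  define K where "K = (C \<times> C) \<inter> {z. F (fst z) + F (snd z) = 1}"
  have psdG: "psd_mat n (G f)" for f unfolding G_def by (rule psd_mult_adjoint) auto
  have trG: "mat_trace (G f) = complex_of_real (F f)" for f
    unfolding G_def F_def by (rule mat_trace_gram)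
  have coord: "continuous_on T (\<lambda>z. fst z p)" "continuous_on T (\<lambda>z. snd z p)"
    for T :: "((nat \<times> nat \<Rightarrow> complex) \<times> (nat \<times> nat \<Rightarrow> complex)) set" and p
    by (rule continuous_on_product_then_coordinatewise, intro continuous_intros)+
  have "closed {z. F (fst z) + F (snd z) = 1}"
    unfolding F_def by (intro closed_Collect_eq continuous_intros coord)
  then have "compact K" unfolding K_def C_def
    by (intro compact_Int_closed compact_Times compact_PiE_UNIV S(1))
  \<comment> \<open>The function with its only nonzero entry at (0, 0), paired with zero;
    \<open>1 \<le> n\<close> makes that entry count in \<open>F\<close>.\<close>
  moreover have "((\<lambda>p. if p = (0, 0) then 1 else 0), (\<lambda>_. 0)) \<in> K"
  proof -
    have "F (\<lambda>p. if p = (0, 0) then 1 else 0) = (\<Sum>k<n. \<Sum>j<n. if k = 0 \<and> j = 0 then 1 else 0)"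
      unfolding F_def by (intro sum.cong) auto
    also have "\<dots> = (\<Sum>k<n. if k = 0 then 1 else 0)"
      using n by (intro sum.cong) (auto simp: sum.delta)
    also have "\<dots> = 1" using n by (simp add: sum.delta)
    finally show ?thesis by (auto simp: K_def C_def F_def S(2))
  qed
  then have "K \<noteq> {}" by blast
  moreover have "continuous_on K (\<lambda>z. dual_gap n A m (G (fst z)) (G (snd z)))"
  proof -
    \<comment> \<open>Expanded into entries, the gap is visibly continuous in the
      coordinates.\<close>
    have e: "dual_gap n A m (G f) (G g) =
      (\<Sum>k<n. (Re (\<Sum>j<n. f (k, j) * cnj (f (k, j))) - Re (\<Sum>j<n. g (k, j) * cnj (g (k, j))))\<^sup>2) +
      (Re (\<Sum>i<n. \<Sum>k<n. A $$ (i, k) * (\<Sum>j<n. f (k, j) * cnj (f (i, j)))) -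
       Re (\<Sum>i<n. \<Sum>k<n. A $$ (i, k) * (\<Sum>j<n. g (k, j) * cnj (g (i, j)))) - m)\<^sup>2" for f g
      using A psd_mat_carrier[OF psdG]
      unfolding dual_gap_def by (simp add: mat_trace_mult[of _ n n] G_def gram_index del: index_mult_mat(1))
    show ?thesis unfolding e by (intro continuous_intros coord)
  qed
  ultimately obtain z where z: "z \<in> K"
    "\<And>y. y \<in> K \<Longrightarrow> dual_gap n A m (G (fst z)) (G (snd z)) \<le> dual_gap n A m (G (fst y)) (G (snd y))"
    using continuous_attains_inf[of K "\<lambda>z. dual_gap n A m (G (fst z)) (G (snd z))"] by blast
  \<comment> \<open>A positive semidefinite matrix is the Gram matrix of its square root. Extension
    by zero outside the index range keeps every coordinate bounded, as membership in the compact
    product demands.\<close>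
  have surj: "\<exists>f. G f = P \<and> (\<forall>p. cmod (f p) ^ 2 \<le> F f)" if P: "psd_mat n P" for P
  proof -
    obtain R where R: "psd_mat n R" "R * R = P" using psd_sqrt_exists[OF P] by blast
    have Rc: "R \<in> carrier_mat n n" "mat_adjoint R = R" using R(1) by (auto simp: psd_mat_def hermitian_mat_def)
    define f where "f p = (if fst p < n \<and> snd p < n then R $$ p else 0)" for p
    have "mat n n f = R" using Rc(1) by (intro eq_matI) (auto simp: f_def)
    then have "G f = P" using Rc(2) R(2) by (simp add: G_def)
    moreover have "cmod (f p) ^ 2 \<le> F f" for p
    proof (cases "fst p < n \<and> snd p < n")
      case True
      have "cmod (f p) ^ 2 \<le> (\<Sum>j<n. (cmod (f (fst p, j)))\<^sup>2)"
        using True member_le_sum[of "snd p" "{..<n}" "\<lambda>j. (cmod (f (fst p, j)))\<^sup>2"] by simp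
      also have "\<dots> \<le> F f" unfolding F_def
        using True member_le_sum[of "fst p" "{..<n}" "\<lambda>k. \<Sum>j<n. (cmod (f (k, j)))\<^sup>2"]
        by (simp add: sum_nonneg)
      finally show ?thesis .
    next
      case False
      then show ?thesis by (auto simp: f_def[of p] F_def intro!: sum_nonneg)
    qed
    ultimately show ?thesis by blast
  qed
  have min: "dual_gap n A m (G (fst z)) (G (snd z)) \<le> dual_gap n A m P N"
    if P: "psd_mat n P" and N: "psd_mat n N" and tr: "mat_trace P + mat_trace N = 1" for P N
  proof -
    from surj[OF P] obtain f where f: "G f = P" "\<And>p. cmod (f p) ^ 2 \<le> F f" by blast
    from surj[OF N] obtain g where g: "G g = N" "\<And>p. cmod (g p) ^ 2 \<le> F g" by blast
    have 1: "F f + F g = 1" using tr trG[of f] trG[of g] f(1) g(1)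
      by (metis of_real_1 of_real_add of_real_eq_iff)
    have nn: "0 \<le> F f" "0 \<le> F g" by (auto simp: F_def intro!: sum_nonneg)
    have "cmod (f p) \<le> 1" "cmod (g p) \<le> 1" for p
      using f(2)[of p] g(2)[of p] 1 nn by (auto intro: power2_le_imp_le[of _ 1])
    then have "(f, g) \<in> K" using 1 S(2) by (auto simp: K_def C_def)
    from z(2)[OF this] show ?thesis using f(1) g(1) by simp
  qed
  have "mat_trace (G (fst z)) + mat_trace (G (snd z)) = 1"
    using z(1) unfolding trG K_def by (metis (mono_tags, lifting) IntD2 mem_Collect_eq of_real_1 of_real_add)
  with psdG min show ?thesis by blast
qed

text \<open>For small \<open>t\<close> the linear term dominates the quadratic one.\<close>

lemma first_order_nonneg:
  fixes c e :: real
  assumes "\<And>t. 0 < t \<Longrightarrow> t \<le> 1 \<Longrightarrow> 0 \<le> 2 * t * c + t\<^sup>2 * e"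
  shows "0 \<le> c"
proof (rule ccontr)
  assume "\<not> 0 \<le> c"
  \<comment> \<open>Chosen so that \<open>t * \<bar>e\<bar> < - c\<close>, which makes
    \<open>2 * c + t * e\<close> negative; the added 1 covers \<open>e = 0\<close>.\<close>
  define t where "t = min 1 (- c / (\<bar>e\<bar> + 1))"
  have t: "0 < t" "t \<le> 1" using \<open>\<not> 0 \<le> c\<close> by (auto simp: t_def divide_neg_pos)
  have "t \<le> - c / (\<bar>e\<bar> + 1)" by (simp add: t_def)
  then have "t * (\<bar>e\<bar> + 1) \<le> - c" by (subst (asm) pos_le_divide_eq) auto
  then have "t * \<bar>e\<bar> \<le> - c - t" by (simp add: algebra_simps)
  moreover have "t * e \<le> t * \<bar>e\<bar>" using t by simp
  ultimately have "2 * c + t * e < 0" using \<open>\<not> 0 \<le> c\<close> t by linarith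
  then have "t * (2 * c + t * e) < 0" using t by (simp add: mult_pos_neg)
  then show False using assms[OF t] by (simp add: algebra_simps power2_eq_square)
qed

text \<open>These test matrices convert inequalities between traces into inequalities for the
  quadratic form of \<open>A\<close>.\<close>

lemma outer_product:
  fixes v :: "complex vec"
  assumes v: "v \<in> carrier_vec n"
  defines "W \<equiv> mat n n (\<lambda>(i, j). v $ i * cnj (v $ j))"
  shows "psd_mat n W" "mat_trace W = complex_of_real ((vec_norm2 v)\<^sup>2)"
    "A \<in> carrier_mat n n \<Longrightarrow> mat_trace (A * W) = (A *\<^sub>v v) \<bullet>c v"
proof -
  let ?V = "mat n 1 (\<lambda>(i, _). v $ i)"
  have "W = ?V * mat_adjoint ?V"
  proof (rule eq_matI)
    fix i j assume "i < dim_row (?V * mat_adjoint ?V)" "j < dim_col (?V * mat_adjoint ?V)"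
    then have "i < n" "j < n" by auto
    then show "W $$ (i, j) = (?V * mat_adjoint ?V) $$ (i, j)"
      unfolding W_def by (subst index_mult_mat_sum[of _ n 1 _ n]) auto
  qed (auto simp: W_def)
  then show "psd_mat n W" using psd_mult_adjoint[of ?V n 1] by simp
  show "mat_trace W = complex_of_real ((vec_norm2 v)\<^sup>2)"
    using v by (simp add: mat_trace_def W_def vec_norm2_sq complex_norm_square del: of_real_power)
  assume A: "A \<in> carrier_mat n n"
  have "mat_trace (A * W) = (\<Sum>i<n. \<Sum>k<n. A $$ (i, k) * (v $ k * cnj (v $ i)))"
    using A by (subst mat_trace_mult[of _ n n]) (auto simp: W_def)
  also have "\<dots> = (\<Sum>i<n. (A *\<^sub>v v) $ i * cnj (v $ i))"
    using A v by (simp add: index_mult_mat_vec_sum[of _ n n] sum_distrib_right mult.assoc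
      del: index_mult_mat_vec)
  finally show "mat_trace (A * W) = (A *\<^sub>v v) \<bullet>c v" using v by (simp add: cscalar_prod_sum)
qed

section \<open>The matrices A(y)\<close>

lemma with_diag_carrier [simp]:
  "A \<in> carrier_mat n n \<Longrightarrow> y \<in> carrier_vec n \<Longrightarrow> with_diag A y \<in> carrier_mat n n"
  by (auto simp: with_diag_def offdiag_def mat_diag_def)

lemma with_diag_index:
  assumes "A \<in> carrier_mat n n" "y \<in> carrier_vec n" "i < n" "j < n"
  shows "with_diag A y $$ (i, j) = (if i = j then complex_of_real (y $ i) else A $$ (i, j))"
  using assms by (auto simp: with_diag_def offdiag_def mat_diag_def)

lemma hermitian_index:
  assumes "hermitian_mat n A" "i < n" "j < n"
  shows "cnj (A $$ (j, i)) = A $$ (i, j)"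
proof -
  have "mat_adjoint A $$ (i, j) = A $$ (i, j)" "A \<in> carrier_mat n n"
    using assms(1) by (auto simp: hermitian_mat_def)
  then show ?thesis using assms(2,3) by auto
qed

lemma hermitian_with_diag:
  assumes "hermitian_mat n A" "y \<in> carrier_vec n"
  shows "hermitian_mat n (with_diag A y)"
proof -
  have A: "A \<in> carrier_mat n n" using assms(1) by (simp add: hermitian_mat_def)
  note c = with_diag_carrier[OF A assms(2)]
  have "mat_adjoint (with_diag A y) = with_diag A y"
  proof (rule eq_matI)
    fix i j assume "i < dim_row (with_diag A y)" "j < dim_col (with_diag A y)"
    then have ij: "i < n" "j < n" using c by auto
    then show "mat_adjoint (with_diag A y) $$ (i, j) = with_diag A y $$ (i, j)"
      using c hermitian_index[OF assms(1) ij] by (auto simp: with_diag_index[OF A assms(2)])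
  qed (use c in auto)
  with c show ?thesis by (simp add: hermitian_mat_def)
qed

lemma with_diag_decomp:
  assumes A: "A \<in> carrier_mat n n" and y: "y \<in> carrier_vec n"
  shows "with_diag A y = A + mat_diag n (\<lambda>i. complex_of_real (y $ i) - A $$ (i, i))"
  using assms carrier_matD[OF with_diag_carrier[OF assms]]
  by (intro eq_matI) (auto simp: with_diag_index mat_diag_def)

text \<open>The mechanism of weak duality: pairing with a matrix of zero diagonal does not see the
  diagonal of A(y).\<close>

lemma mat_trace_with_diag_mult:
  assumes A: "A \<in> carrier_mat n n" and y: "y \<in> carrier_vec n" and X: "X \<in> carrier_mat n n"
    and "\<And>k. k < n \<Longrightarrow> X $$ (k, k) = 0"
  shows "mat_trace (with_diag A y * X) = mat_trace (A * X)"
  unfolding mat_trace_mult[OF with_diag_carrier[OF A y] X] mat_trace_mult[OF A X]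
  using assms by (intro sum.cong refl) (auto simp: with_diag_index)

lemma convex_combination_psd:
  assumes "psd_mat n P" "psd_mat n R" "0 \<le> t" "t \<le> 1"
  shows "psd_mat n (complex_of_real (1 - t) \<cdot>\<^sub>m P + complex_of_real t \<cdot>\<^sub>m R)"
  using assms by (intro psd_add psd_smult) auto

text \<open>First-order optimality: at a minimizer of the gap the residual \<open>(r, s)\<close> is a normal vector
  of the convex set of all data, which separates that set from the target \<open>(0, m)\<close>.\<close>

lemma min_dual_gap_normal:
  assumes A: "A \<in> carrier_mat n n"
    and P: "psd_mat n P" and N: "psd_mat n N" and tr: "mat_trace P + mat_trace N = 1"
    and min: "\<And>P' N'. psd_mat n P' \<Longrightarrow> psd_mat n N' \<Longrightarrow> mat_trace P' + mat_trace N' = 1 \<Longrightarrow>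
      dual_gap n A m P N \<le> dual_gap n A m P' N'"
    and P': "psd_mat n P'" and N': "psd_mat n N'" and tr': "mat_trace P' + mat_trace N' = 1"
  defines "r \<equiv> \<lambda>k. Re (P $$ (k, k)) - Re (N $$ (k, k))"
    and "s \<equiv> Re (mat_trace (A * P)) - Re (mat_trace (A * N)) - m"
  shows "dual_gap n A m P N \<le>
    (\<Sum>k<n. r k * (Re (P' $$ (k, k)) - Re (N' $$ (k, k)))) +
    s * (Re (mat_trace (A * P')) - Re (mat_trace (A * N')) - m)"
proof -
  define r' where "r' k = Re (P' $$ (k, k)) - Re (N' $$ (k, k))" for k
  define s' where "s' = Re (mat_trace (A * P')) - Re (mat_trace (A * N')) - m"
  define mix where "mix t R R' = complex_of_real (1 - t) \<cdot>\<^sub>m R + complex_of_real t \<cdot>\<^sub>m R'" for t R R'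
  have c: "P \<in> carrier_mat n n" "N \<in> carrier_mat n n" "P' \<in> carrier_mat n n" "N' \<in> carrier_mat n n"
    using P N P' N' by auto
  have mix_index: "Re (mix t R R' $$ (k, k)) = (1 - t) * Re (R $$ (k, k)) + t * Re (R' $$ (k, k))"
    if "R \<in> carrier_mat n n" "R' \<in> carrier_mat n n" "k < n" for t R R' k
    using that by (simp add: mix_def)
  have mix_trace: "mat_trace (mix t R R') = complex_of_real (1 - t) * mat_trace R + complex_of_real t * mat_trace R'"
    if "R \<in> carrier_mat n n" "R' \<in> carrier_mat n n" for t R R'
    using that unfolding mix_def by (simp add: mat_trace_add[of _ n] mat_trace_smult[of _ n])
  have mix_A: "A * mix t R R' = complex_of_real (1 - t) \<cdot>\<^sub>m (A * R) + complex_of_real t \<cdot>\<^sub>m (A * R')"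
    if "R \<in> carrier_mat n n" "R' \<in> carrier_mat n n" for t R R'
    using that A unfolding mix_def
    by (simp add: mult_add_distrib_mat[of _ n n _ n] mult_smult_distrib[of _ n n _ n])
  have mix_AT: "Re (mat_trace (A * mix t R R')) = (1 - t) * Re (mat_trace (A * R)) + t * Re (mat_trace (A * R'))"
    if "R \<in> carrier_mat n n" "R' \<in> carrier_mat n n" for t R R'
    using that A unfolding mix_A[OF that] by (simp add: mat_trace_add[of _ n] mat_trace_smult[of _ n])
  \<comment> \<open>Along the segment towards \<open>(P', N')\<close> the gap is its initial value
    plus \<open>2 * t * ?c + t\<^sup>2 * ?e\<close>; minimality at the starting point therefore
    gives \<open>0 \<le> ?c\<close>.\<close>
  let ?c = "(\<Sum>k<n. r k * (r' k - r k)) + s * (s' - s)"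
  let ?e = "(\<Sum>k<n. (r' k - r k)\<^sup>2) + (s' - s)\<^sup>2"
  have gap: "dual_gap n A m P N = (\<Sum>k<n. (r k)\<^sup>2) + s\<^sup>2" by (simp add: dual_gap_def r_def s_def)
  have "0 \<le> ?c"
  proof (rule first_order_nonneg)
    fix t :: real assume t: "0 < t" "t \<le> 1"
    have "mat_trace (mix t P P') + mat_trace (mix t N N') =
      complex_of_real (1 - t) * (mat_trace P + mat_trace N) + complex_of_real t * (mat_trace P' + mat_trace N')"
      unfolding mix_trace[OF c(1,3)] mix_trace[OF c(2,4)] by (simp add: algebra_simps)
    also have "\<dots> = 1" unfolding tr tr' by simp
    finally have "dual_gap n A m P N \<le> dual_gap n A m (mix t P P') (mix t N N')"
      using t P N P' N' unfolding mix_def by (intro min convex_combination_psd) auto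
    also have "\<dots> = (\<Sum>k<n. (r k + t * (r' k - r k))\<^sup>2) + (s + t * (s' - s))\<^sup>2"
      unfolding dual_gap_def mix_AT[OF c(1,3)] mix_AT[OF c(2,4)]
      using c by (simp add: mix_index r_def r'_def s_def s'_def algebra_simps)
    also have "\<dots> = (\<Sum>k<n. (r k)\<^sup>2) + s\<^sup>2 + (2 * t * ?c + t\<^sup>2 * ?e)"
    proof -
      have "(\<Sum>k<n. (r k + t * (r' k - r k))\<^sup>2) =
        (\<Sum>k<n. (r k)\<^sup>2) + 2 * t * (\<Sum>k<n. r k * (r' k - r k)) + t\<^sup>2 * (\<Sum>k<n. (r' k - r k)\<^sup>2)"
        unfolding sum_distrib_left sum.distrib[symmetric]
        by (intro sum.cong refl) (simp add: power2_eq_square algebra_simps)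
      moreover have "(s + t * (s' - s))\<^sup>2 = s\<^sup>2 + 2 * t * (s * (s' - s)) + t\<^sup>2 * (s' - s)\<^sup>2"
        by (simp add: power2_eq_square algebra_simps)
      ultimately show ?thesis by (simp only: distrib_left)
    qed
    finally show "0 \<le> 2 * t * ?c + t\<^sup>2 * ?e" unfolding gap by simp
  qed
  \<comment> \<open>Expanding the products shows that \<open>?c\<close> is the right-hand side of
    the claim minus the gap.\<close>
  also have "?c = (\<Sum>k<n. r k * r' k) + s * s' - ((\<Sum>k<n. (r k)\<^sup>2) + s\<^sup>2)"
    by (simp add: power2_eq_square sum_subtractf algebra_simps)
  finally show ?thesis unfolding gap r'_def s'_def by simp
qed

text \<open>If the gap is positive, the normal vector \<open>(y, c)\<close> at the minimizer, tested on rank-one matrices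
  \<open>v v\<^sup>*\<close>, bounds the quadratic form of \<open>c A + Diag(y)\<close>; this forces \<open>c > 0\<close>, and adding
  \<open>y / c\<close> to the diagonal decreases the norm.\<close>

lemma minimal_imp_dual_gap_0:
  assumes A: "hermitian_mat n A" and n: "1 \<le> n"
    and minimal: "\<forall>y\<in>carrier_vec n. spectral_norm A \<le> spectral_norm (with_diag A y)"
    and P: "psd_mat n P" and N: "psd_mat n N" and tr: "mat_trace P + mat_trace N = 1"
    and min: "\<And>P' N'. psd_mat n P' \<Longrightarrow> psd_mat n N' \<Longrightarrow> mat_trace P' + mat_trace N' = 1 \<Longrightarrow>
      dual_gap n A (spectral_norm A) P N \<le> dual_gap n A (spectral_norm A) P' N'"
  shows "dual_gap n A (spectral_norm A) P N = 0"
proof (rule ccontr)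
  let ?m = "spectral_norm A"
  define g where "g = dual_gap n A ?m P N"
  assume "dual_gap n A ?m P N \<noteq> 0"
  moreover have "0 \<le> dual_gap n A ?m P N" by (auto simp: dual_gap_def intro!: add_nonneg_nonneg sum_nonneg)
  ultimately have g: "0 < g" by (simp add: g_def)
  have Ac: "A \<in> carrier_mat n n" using A by (simp add: hermitian_mat_def)
  \<comment> \<open>The residual is negated, here and in \<open>c\<close>, so that the normal
    inequality becomes an upper bound.\<close>
  define y where "y k = - (Re (P $$ (k, k)) - Re (N $$ (k, k)))" for k
  define c where "c = - (Re (mat_trace (A * P)) - Re (mat_trace (A * N)) - ?m)"
  have normal: "(\<Sum>k<n. y k * (Re (P' $$ (k, k)) - Re (N' $$ (k, k)))) +
      c * (Re (mat_trace (A * P')) - Re (mat_trace (A * N'))) \<le> c * ?m - g"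
    if "psd_mat n P'" "psd_mat n N'" "mat_trace P' + mat_trace N' = 1" for P' N'
  proof -
    have "g \<le> (\<Sum>k<n. - y k * (Re (P' $$ (k, k)) - Re (N' $$ (k, k)))) +
        - c * (Re (mat_trace (A * P')) - Re (mat_trace (A * N')) - ?m)"
      using min_dual_gap_normal[OF Ac P N tr min that] by (simp only: y_def c_def g_def minus_minus)
    then have "g \<le> - (\<Sum>k<n. y k * (Re (P' $$ (k, k)) - Re (N' $$ (k, k)))) +
        - c * (Re (mat_trace (A * P')) - Re (mat_trace (A * N')) - ?m)"
      unfolding sum_negf[symmetric] by (simp only: mult_minus_left)
    moreover have "g' \<le> - a + - c * (b - m) \<Longrightarrow> a + c * b \<le> c * m - g'" for a b m g' :: real
      by (simp add: algebra_simps)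
    ultimately show ?thesis by blast
  qed
  have "0\<^sub>m n n *\<^sub>v v = 0\<^sub>v n" if "v \<in> carrier_vec n" for v :: "complex vec"
    using that by (intro eq_vecI) auto
  then have Z: "psd_mat n (0\<^sub>m n n)" "mat_trace (0\<^sub>m n n) = 0"
    by (auto simp: psd_mat_def hermitian_mat_def mat_trace_def intro!: eq_matI)
  have AZ: "mat_trace (A * 0\<^sub>m n n) = 0"
    using Ac Z(2) by (simp add: right_mult_zero_mat[of _ n])
  let ?q = "\<lambda>v. (\<Sum>k<n. y k * (cmod (v $ k))\<^sup>2) + c * Re ((A *\<^sub>v v) \<bullet>c v)"
  have q: "\<bar>?q v\<bar> \<le> c * ?m - g" if v: "v \<in> carrier_vec n" "vec_norm2 v = 1" for v
  proof -
    obtain W where W: "psd_mat n W" "mat_trace W = 1" "mat_trace (A * W) = (A *\<^sub>v v) \<bullet>c v"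
      "\<And>k. k < n \<Longrightarrow> Re (W $$ (k, k)) = (cmod (v $ k))\<^sup>2"
    proof
      show "mat_trace (mat n n (\<lambda>(i, j). v $ i * cnj (v $ j))) = 1"
        using outer_product(2)[OF v(1)] v(2) by simp
      show "Re (mat n n (\<lambda>(i, j). v $ i * cnj (v $ j)) $$ (k, k)) = (cmod (v $ k))\<^sup>2" if "k < n" for k
        using that by (simp add: cmod_power2) (simp add: power2_eq_square)
    qed (use outer_product[OF v(1)] Ac in blast)+
    \<comment> \<open>The pair \<open>(W, 0)\<close> bounds the form from above, and
      \<open>(0, W)\<close> below bounds it from the other side.\<close>
    have "?q v \<le> c * ?m - g"
      using normal[OF W(1) Z(1)] Z(2) AZ by (simp add: W)
    moreover have "- ?q v \<le> c * ?m - g"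
      using normal[OF Z(1) W(1)] Z(2) AZ by (simp add: W sum_negf)
    ultimately show ?thesis by linarith
  qed
  \<comment> \<open>The right-hand side of \<open>q\<close> bounds an absolute value. As
    \<open>g > 0\<close> and the norm is nonnegative, this leaves only \<open>c > 0\<close>.\<close>
  have "0 \<le> c * ?m - g"
    using q[of "unit_vec n 0"] vec_norm2_unit_vec[of 0 n] n by fastforce
  then have "0 < c * ?m" using g by simp
  then have c: "0 < c" using spectral_norm_nonneg[OF A n] by (simp add: zero_less_mult_iff)
  define z where "z = vec n (\<lambda>k. Re (A $$ (k, k)) + y k / c)"
  have z: "z \<in> carrier_vec n" by (simp add: z_def)
  have diag: "complex_of_real (z $ k) - A $$ (k, k) = complex_of_real (y k / c)" if "k < n" for k
    using hermitian_index[OF A that that] that by (simp add: z_def complex_eq_iff)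
  have "spectral_norm (with_diag A z) \<le> ?m - g / c"
  proof (rule spectral_norm_le_quadratic_form[OF hermitian_with_diag[OF A z] n])
    fix v assume v: "v \<in> carrier_vec n" "vec_norm2 v = 1"
    let ?D = "mat_diag n (\<lambda>i. complex_of_real (z $ i) - A $$ (i, i))"
    have D: "(?D *\<^sub>v v) \<bullet>c v = complex_of_real (\<Sum>k<n. y k / c * (cmod (v $ k))\<^sup>2)"
    proof -
      have "(?D *\<^sub>v v) \<bullet>c v = (\<Sum>k<n. complex_of_real (y k / c) * (v $ k * cnj (v $ k)))"
        using v(1) by (simp add: cscalar_prod_sum mat_diag_mult_vec diag mult.assoc del: of_real_divide)
      then show ?thesis by (simp only: complex_norm_square[symmetric] of_real_mult[symmetric] of_real_sum)
    qed
    have "(with_diag A z *\<^sub>v v) \<bullet>c v = (A *\<^sub>v v) \<bullet>c v + (?D *\<^sub>v v) \<bullet>c v"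
      unfolding with_diag_decomp[OF Ac z] using Ac v(1)
      by (simp add: add_mult_distrib_mat_vec[of _ n n] add_scalar_prod_distrib[of _ n])
    then have "Re ((with_diag A z *\<^sub>v v) \<bullet>c v) = ?q v / c"
      using c by (simp add: D sum_divide_distrib add_divide_distrib)
    then have "\<bar>Re ((with_diag A z *\<^sub>v v) \<bullet>c v)\<bar> = \<bar>?q v\<bar> / c" using c by simp
    also have "\<dots> \<le> (c * ?m - g) / c" using q[OF v] c by (intro divide_right_mono) auto
    finally show "\<bar>Re ((with_diag A z *\<^sub>v v) \<bullet>c v)\<bar> \<le> ?m - g / c"
      using c by (simp add: diff_divide_distrib)
  qed
  moreover have "0 < g / c" using g c by simp
  ultimately show False using minimal z by force
qed

section \<open>From minimality to certificates\<close>

definition certificate :: "nat \<Rightarrow> complex mat \<Rightarrow> complex mat \<Rightarrow> complex mat \<Rightarrow> bool" where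
  "certificate n A P N \<longleftrightarrow> psd_mat n P \<and> psd_mat n N \<and> mat_trace P + mat_trace N = 1 \<and>
     (\<forall>k<n. P $$ (k, k) = N $$ (k, k)) \<and>
     A * P = complex_of_real (spectral_norm A) \<cdot>\<^sub>m P \<and>
     A * N = complex_of_real (- spectral_norm A) \<cdot>\<^sub>m N"

text \<open>The signs 1 and -1 give the two slack matrices ||A|| - A and ||A|| + A, which multiply
  \<open>P\<close> and \<open>N\<close> respectively in the complementary slackness
  argument.\<close>

lemma psd_shift:
  assumes A: "hermitian_mat n A" and n: "1 \<le> n" and s: "\<bar>s\<bar> = 1"
  defines "M \<equiv> complex_of_real (spectral_norm A) \<cdot>\<^sub>m 1\<^sub>m n - complex_of_real s \<cdot>\<^sub>m A"
  shows "psd_mat n M"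
proof -
  obtain Q where uQ: "unitary_mat n Q" and AQ: "A = herm_fun n Q (eig A)"
    using hermitian_spectral[OF A] by blast
  note Q = unitary_matD[OF uQ]
  have Ac: "A \<in> carrier_mat n n" using A by (simp add: hermitian_mat_def)
  let ?d = "\<lambda>i. spectral_norm A - s * eig A i"
  have AQ': "A * Q = Q * mat_diag n (\<lambda>i. complex_of_real (eig A i))"
    by (subst AQ) (rule herm_fun_mult_unitary[OF uQ])
  have "M * Q = complex_of_real (spectral_norm A) \<cdot>\<^sub>m Q - complex_of_real s \<cdot>\<^sub>m (A * Q)"
    unfolding M_def using Ac Q(1)
    by (simp add: minus_mult_distrib_mat[of _ n n _ _ n] mult_smult_assoc_mat[of _ n n _ n])
  also have "\<dots> = Q * mat_diag n (\<lambda>i. complex_of_real (?d i))"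
    unfolding AQ' mat_diag_mult_right[OF Q(1)] using Q(1)
    by (intro eq_matI) (auto simp: algebra_simps)
  finally have "M = herm_fun n Q ?d"
    using Ac by (intro herm_funI[OF uQ]) (auto simp: M_def)
  moreover have "0 \<le> ?d i" if "i < n" for i
  proof -
    have "s * eig A i \<le> \<bar>s * eig A i\<bar>" by simp
    also have "\<dots> \<le> spectral_norm A"
      using abs_eig_le_spectral_norm[OF A that] s by (simp add: abs_mult)
    finally show ?thesis by simp
  qed
  ultimately show ?thesis using psd_herm_fun[OF uQ] by simp
qed

lemma minimal_imp_certificate:
  assumes A: "hermitian_mat n A" and n: "1 \<le> n"
    and minimal: "\<forall>y\<in>carrier_vec n. spectral_norm A \<le> spectral_norm (with_diag A y)"
  shows "\<exists>P N. certificate n A P N"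
proof -
  let ?m = "spectral_norm A"
  have Ac: "A \<in> carrier_mat n n" using A by (simp add: hermitian_mat_def)
  obtain P N where P: "psd_mat n P" and N: "psd_mat n N" and tr: "mat_trace P + mat_trace N = 1"
    and min: "\<And>P' N'. psd_mat n P' \<Longrightarrow> psd_mat n N' \<Longrightarrow> mat_trace P' + mat_trace N' = 1 \<Longrightarrow>
      dual_gap n A ?m P N \<le> dual_gap n A ?m P' N'"
    using exists_min_dual_gap[OF Ac n] by blast
  have c: "P \<in> carrier_mat n n" "N \<in> carrier_mat n n" using P N by auto
  have gap0: "dual_gap n A ?m P N = 0" by (rule minimal_imp_dual_gap_0[OF A n minimal P N tr min])
  have S0: "0 \<le> (\<Sum>k<n. (Re (P $$ (k, k)) - Re (N $$ (k, k)))\<^sup>2)" by (intro sum_nonneg) auto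
  have 1: "(\<Sum>k<n. (Re (P $$ (k, k)) - Re (N $$ (k, k)))\<^sup>2) = 0"
    and 2: "Re (mat_trace (A * P)) - Re (mat_trace (A * N)) - ?m = 0"
    using gap0 S0 unfolding dual_gap_def by (simp_all add: add_nonneg_eq_0_iff)
  have diag: "P $$ (k, k) = N $$ (k, k)" if k: "k < n" for k
  proof -
    have "Re (P $$ (k, k)) = Re (N $$ (k, k))" using 1 k by (subst (asm) sum_nonneg_eq_0_iff) auto
    \<comment> \<open>The gap compares only real parts; diagonal entries of Hermitian matrices are
      real.\<close>
    moreover have "cnj (P $$ (k, k)) = P $$ (k, k)" "cnj (N $$ (k, k)) = N $$ (k, k)"
      using P N hermitian_index k unfolding psd_mat_def by blast+
    ultimately show ?thesis by (simp add: complex_eq_iff)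
  qed
  let ?M = "\<lambda>s. complex_of_real ?m \<cdot>\<^sub>m 1\<^sub>m n - complex_of_real s \<cdot>\<^sub>m A"
  have MR: "?M s * R = complex_of_real ?m \<cdot>\<^sub>m R - complex_of_real s \<cdot>\<^sub>m (A * R)"
    if "R \<in> carrier_mat n n" for s R
    using that Ac by (simp add: minus_mult_distrib_mat[of _ n n _ _ n] mult_smult_assoc_mat[of _ n n _ n])
  have tM: "mat_trace (?M s * R) = complex_of_real ?m * mat_trace R - complex_of_real s * mat_trace (A * R)"
    if "R \<in> carrier_mat n n" for s R
    unfolding MR[OF that] using that Ac by (simp add: mat_trace_minus[of _ n] mat_trace_smult[of _ n])
  have psd1: "psd_mat n (?M 1)" "psd_mat n (?M (- 1))" by (rule psd_shift[OF A n], simp)+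
  note t1 = psd_mult_trace_nonneg[OF psd1(1) P] and t2 = psd_mult_trace_nonneg[OF psd1(2) N]
  have "Re (mat_trace (?M 1 * P)) + Re (mat_trace (?M (- 1) * N)) =
    ?m * Re (mat_trace P + mat_trace N) - (Re (mat_trace (A * P)) - Re (mat_trace (A * N)))"
    unfolding tM[OF c(1)] tM[OF c(2)] by (simp add: algebra_simps)
  also have "\<dots> = 0" using 2 by (simp add: tr)
  finally have "Re (mat_trace (?M 1 * P)) = 0" "Re (mat_trace (?M (- 1) * N)) = 0"
    using t1(2) t2(2) by linarith+
  then have "mat_trace (?M 1 * P) = 0" "mat_trace (?M (- 1) * N) = 0"
    using t1(1) t2(1) by simp_all
  from psd_mult_eq_0[OF psd1(1) P this(1)] psd_mult_eq_0[OF psd1(2) N this(2)]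
  have z: "complex_of_real ?m \<cdot>\<^sub>m P - complex_of_real 1 \<cdot>\<^sub>m (A * P) = 0\<^sub>m n n"
    "complex_of_real ?m \<cdot>\<^sub>m N - complex_of_real (- 1) \<cdot>\<^sub>m (A * N) = 0\<^sub>m n n"
    unfolding MR[OF c(1)] MR[OF c(2)] .
  have AP: "A * P = complex_of_real ?m \<cdot>\<^sub>m P"
  proof (rule eq_matI)
    fix i j assume ij: "i < dim_row (complex_of_real ?m \<cdot>\<^sub>m P)" "j < dim_col (complex_of_real ?m \<cdot>\<^sub>m P)"
    then show "(A * P) $$ (i, j) = (complex_of_real ?m \<cdot>\<^sub>m P) $$ (i, j)"
      using arg_cong[OF z(1), of "\<lambda>M. M $$ (i, j)"] c(1) Ac by (simp del: index_mult_mat(1))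
  qed (use c(1) Ac in auto)
  have AN: "A * N = complex_of_real (- ?m) \<cdot>\<^sub>m N"
  proof (rule eq_matI)
    fix i j assume ij: "i < dim_row (complex_of_real (- ?m) \<cdot>\<^sub>m N)" "j < dim_col (complex_of_real (- ?m) \<cdot>\<^sub>m N)"
    then show "(A * N) $$ (i, j) = (complex_of_real (- ?m) \<cdot>\<^sub>m N) $$ (i, j)"
      using arg_cong[OF z(2), of "\<lambda>M. M $$ (i, j)"] c(2) Ac
      by (simp add: eq_neg_iff_add_eq_0 add.commute del: index_mult_mat(1))
  qed (use c(2) Ac in auto)
  show ?thesis using P N tr diag AP AN unfolding certificate_def by blast
qed

subsection \<open>Orthonormal frames of the extreme eigenspaces\<close>

lemma herm_fun_index:
  assumes "Q \<in> carrier_mat n n" "i < n" "k < n"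
  shows "herm_fun n Q d $$ (i, k) = (\<Sum>j<n. Q $$ (i, j) * complex_of_real (d j) * cnj (Q $$ (k, j)))"
  unfolding herm_fun_def mat_diag_mult_right[OF assms(1)] using assms
  by (subst index_mult_mat_sum[of _ n n _ n]) auto

lemma eigenmatrix_spectral_proj:
  assumes "hermitian_mat n A"
  shows "spectral_proj A a \<in> carrier_mat n n"
    and "A * spectral_proj A a = complex_of_real a \<cdot>\<^sub>m spectral_proj A a"
proof -
  obtain Q where uQ: "unitary_mat n Q" and AQ: "A = herm_fun n Q (eig A)"
    using hermitian_spectral[OF assms] by blast
  note Q = unitary_matD[OF uQ]
  let ?e = "\<lambda>i. if eig A i = a then 1 else 0 :: real"
  have E: "spectral_proj A a = herm_fun n Q ?e" by (rule spectral_proj_herm_fun(1)[OF uQ AQ])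
  then show "spectral_proj A a \<in> carrier_mat n n" using Q(1) by simp
  have "A * spectral_proj A a = herm_fun n Q (\<lambda>i. eig A i * ?e i)"
    unfolding E by (subst AQ) (rule herm_fun_mult[OF uQ])
  also have "\<dots> = complex_of_real a \<cdot>\<^sub>m spectral_proj A a" unfolding E
  proof (rule eq_matI)
    fix i k assume "i < dim_row (complex_of_real a \<cdot>\<^sub>m herm_fun n Q ?e)"
      "k < dim_col (complex_of_real a \<cdot>\<^sub>m herm_fun n Q ?e)"
    then have "i < n" "k < n" using Q(1) by auto
    then show "herm_fun n Q (\<lambda>i. eig A i * ?e i) $$ (i, k) =
      (complex_of_real a \<cdot>\<^sub>m herm_fun n Q ?e) $$ (i, k)"
      using Q(1) by (auto simp: herm_fun_index[OF Q(1)] sum_distrib_left intro!: sum.cong)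
  qed auto
  finally show "A * spectral_proj A a = complex_of_real a \<cdot>\<^sub>m spectral_proj A a" .
qed

lemma ordered_eigenbasis_exists:
  assumes "hermitian_mat n A"
  shows "\<exists>q. ordered_eigenbasis n A q"
proof -
  obtain Q where uQ: "unitary_mat n Q" and AQ: "A = herm_fun n Q (eig A)"
    using hermitian_spectral[OF assms] by blast
  note Q = unitary_matD[OF uQ]
  have "A *\<^sub>v col Q i = complex_of_real (eig A i) \<cdot>\<^sub>v col Q i" if "i < n" for i
    using herm_fun_col[OF uQ that, of "eig A"] AQ by simp
  then have "ordered_eigenbasis n A (cols Q)"
    using Q(1) col_unitary_orthonormal[OF uQ] cols_dim[of Q] by (auto simp: ordered_eigenbasis_def)
  then show ?thesis by blast
qed

lemma ordered_eigenbasis_unitary: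
  assumes q: "ordered_eigenbasis n A q" and A: "A \<in> carrier_mat n n"
  shows "unitary_mat n (mat_of_cols n q)" "A = herm_fun n (mat_of_cols n q) (eig A)"
proof -
  have len: "length q = n" and c: "set q \<subseteq> carrier_vec n"
    and orth: "\<And>i j. i < n \<Longrightarrow> j < n \<Longrightarrow> q ! i \<bullet>c q ! j = (if i = j then 1 else 0)"
    and ev: "\<And>i. i < n \<Longrightarrow> A *\<^sub>v (q ! i) = complex_of_real (eig A i) \<cdot>\<^sub>v (q ! i)"
    using q by (auto simp: ordered_eigenbasis_def)
  show u: "unitary_mat n (mat_of_cols n q)" by (rule unitary_mat_of_orthonormal[OF c len orth])
  let ?Q = "mat_of_cols n q"
  have Q: "?Q \<in> carrier_mat n n" using unitary_matD(1)[OF u] .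
  have qc: "q ! i \<in> carrier_vec n" if "i < n" for i using c len that by auto
  have "A * ?Q = ?Q * mat_diag n (\<lambda>i. complex_of_real (eig A i))"
    unfolding mat_diag_mult_right[OF Q]
  proof (rule eq_matI)
    fix i j assume "i < dim_row (mat n n (\<lambda>(i, j). ?Q $$ (i, j) * complex_of_real (eig A j)))"
      "j < dim_col (mat n n (\<lambda>(i, j). ?Q $$ (i, j) * complex_of_real (eig A j)))"
    then have ij: "i < n" "j < n" by auto
    have "(A * ?Q) $$ (i, j) = (A *\<^sub>v (q ! j)) $ i" using A len ij qc by simp
    also have "\<dots> = complex_of_real (eig A j) * q ! j $ i"
      unfolding ev[OF ij(2)] using ij carrier_vecD[OF qc[OF ij(2)]] by simp
    finally show "(A * ?Q) $$ (i, j) = mat n n (\<lambda>(i, j). ?Q $$ (i, j) * complex_of_real (eig A j)) $$ (i, j)"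
      using ij len by (simp add: mat_of_cols_index)
  qed (use A len in auto)
  then show "A = herm_fun n ?Q (eig A)" by (rule herm_funI[OF u A])
qed

text \<open>Treats both frames of b) at once: the first \<open>t\<close> columns are the segment
  from 0 to t, the last \<open>s\<close> columns the segment from n - s to n.\<close>

lemma mat_of_cols_segment:
  assumes u: "unitary_mat n (mat_of_cols n q)" and len: "length q = n" and ab: "a \<le> b" "b \<le> n"
  defines "R \<equiv> mat_of_cols n (map ((!) q) [a..<b])"
  shows "R \<in> carrier_mat n (b - a)"
    and "R * mat_adjoint R = herm_fun n (mat_of_cols n q) (\<lambda>i. if a \<le> i \<and> i < b then 1 else 0)"
    and "mat_adjoint R * R = 1\<^sub>m (b - a)"
proof -
  let ?Q = "mat_of_cols n q"
  note Q = unitary_matD[OF u]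
  show R: "R \<in> carrier_mat n (b - a)" unfolding R_def by (rule carrier_matI) auto
  have Ri: "R $$ (i, j) = ?Q $$ (i, a + j)" if "i < n" "j < b - a" for i j
    using that ab len by (simp add: R_def mat_of_cols_index)
  show "R * mat_adjoint R = herm_fun n ?Q (\<lambda>i. if a \<le> i \<and> i < b then 1 else 0)"
  proof (rule eq_matI)
    let ?H = "herm_fun n ?Q (\<lambda>i. if a \<le> i \<and> i < b then 1 else 0)"
    fix i k assume "i < dim_row ?H" "k < dim_col ?H"
    then have ik: "i < n" "k < n" by auto
    have "(R * mat_adjoint R) $$ (i, k) = (\<Sum>j<b - a. ?Q $$ (i, a + j) * cnj (?Q $$ (k, a + j)))"
      using ik R by (subst index_mult_mat_sum[of _ n "b - a" _ n]) (auto simp: Ri)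
    also have "\<dots> = (\<Sum>j\<in>{a..<b}. ?Q $$ (i, j) * cnj (?Q $$ (k, j)))"
      by (rule sum.reindex_bij_witness[of _ "\<lambda>j. j - a" "\<lambda>j. a + j"]) auto
    also have "\<dots> = (\<Sum>j<n. ?Q $$ (i, j) * complex_of_real (if a \<le> j \<and> j < b then 1 else 0) * cnj (?Q $$ (k, j)))"
      using ab by (intro sum.mono_neutral_cong_left) auto
    finally show "(R * mat_adjoint R) $$ (i, k) = ?H $$ (i, k)"
      unfolding herm_fun_index[OF Q(1) ik] .
  qed (use R in auto)
  show "mat_adjoint R * R = 1\<^sub>m (b - a)"
  proof (rule eq_matI)
    fix i k assume "i < dim_row (1\<^sub>m (b - a) :: complex mat)" "k < dim_col (1\<^sub>m (b - a) :: complex mat)"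
    then have ik: "i < b - a" "k < b - a" by auto
    have "(mat_adjoint R * R) $$ (i, k) = (\<Sum>j<n. cnj (?Q $$ (j, a + i)) * ?Q $$ (j, a + k))"
      using ik R by (subst index_mult_mat_sum[of _ "b - a" n _ "b - a"]) (auto simp: Ri)
    also have "\<dots> = (mat_adjoint ?Q * ?Q) $$ (a + i, a + k)"
      using ik ab Q(1) len by (subst index_mult_mat_sum[of _ n n _ n]) auto
    finally show "(mat_adjoint R * R) $$ (i, k) = 1\<^sub>m (b - a) $$ (i, k)"
      using ik ab unfolding Q(2) by auto
  qed (use R in auto)
qed

lemma down_closed_eq_lessThan:
  assumes "S \<subseteq> {..<n}" "\<And>i j. j \<in> S \<Longrightarrow> i \<le> j \<Longrightarrow> i \<in> S"
  shows "S = {..<card S}" "card S \<le> n"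
proof -
  have fin: "finite S" using assms(1) finite_subset by blast
  show "card S \<le> n" using card_mono[OF _ assms(1)] by simp
  show "S = {..<card S}"
  proof (cases "S = {}")
    case False
    have "S = {..Max S}" using assms(2)[OF Max_in[OF fin False]] Max_ge[OF fin] by auto
    then show ?thesis by (metis card_atMost lessThan_Suc_atMost)
  qed simp
qed

text \<open>The eigenvalues decrease, so the indices of the largest one form an initial segment
  whose length is the multiplicity. Hence the first \<open>t\<close> vectors of \<open>q\<close> are
  exactly those belonging to \<open>eig A 0\<close>.\<close>

lemma eig_top_indices:
  assumes A: "hermitian_mat n A"
  shows "eig_mult A (eig A 0) \<le> n" "i < n \<Longrightarrow> eig A i = eig A 0 \<longleftrightarrow> i < eig_mult A (eig A 0)"
proof -
  let ?S = "{i. i < n \<and> eig A i = eig A 0}"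
  have down: "i \<in> ?S" if "j \<in> ?S" "i \<le> j" for i j
    using that eig_antimono[OF A, of i j] eig_antimono[OF A, of 0 i] by auto
  have sub: "?S \<subseteq> {..<n}" by auto
  have S: "?S = {..<card ?S}" "card ?S \<le> n"
    by (rule down_closed_eq_lessThan[OF sub], erule (1) down)+
  have c: "eig_mult A (eig A 0) = card ?S" by (rule eig_mult_eq_card[OF A])
  show "eig_mult A (eig A 0) \<le> n" unfolding c by (rule S(2))
  assume "i < n"
  then have "eig A i = eig A 0 \<longleftrightarrow> i \<in> ?S" by simp
  also have "\<dots> \<longleftrightarrow> i < card ?S" using S(1) by (metis lessThan_iff)
  finally show "eig A i = eig A 0 \<longleftrightarrow> i < eig_mult A (eig A 0)" unfolding c .
qed

lemma eig_bottom_indices: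
  assumes A: "hermitian_mat n A"
  defines "s \<equiv> eig_mult A (eig A (n - 1))"
  shows "s \<le> n" "i < n \<Longrightarrow> eig A i = eig A (n - 1) \<longleftrightarrow> n - s \<le> i"
proof -
  \<comment> \<open>The reflection of \<open>i\<close> to \<open>n - 1 - i\<close> turns the final
    segment of indices into an initial one.\<close>
  let ?S = "{i. i < n \<and> eig A (n - 1 - i) = eig A (n - 1)}"
  have "card ?S = card {i. i < n \<and> eig A i = eig A (n - 1)}"
    by (rule bij_betw_same_card[of "\<lambda>i. n - 1 - i"], rule bij_betw_byWitness[of _ "\<lambda>i. n - 1 - i"]) auto
  then have s: "s = card ?S" unfolding s_def eig_mult_eq_card[OF A] by simp
  have down: "i \<in> ?S" if "j \<in> ?S" "i \<le> j" for i j
    using that eig_antimono[OF A diff_le_mono2[OF that(2), of "n - 1"]]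
      eig_antimono[OF A diff_le_self, of "n - 1" i] by auto
  have sub: "?S \<subseteq> {..<n}" by auto
  have S: "?S = {..<s}" "s \<le> n" unfolding s
    by (rule down_closed_eq_lessThan[OF sub], erule (1) down)+
  show "s \<le> n" by (rule S(2))
  assume i: "i < n"
  then have "eig A i = eig A (n - 1) \<longleftrightarrow> n - 1 - i \<in> ?S" by auto
  then show "eig A i = eig A (n - 1) \<longleftrightarrow> n - s \<le> i" unfolding S(1) using i S(2) by auto
qed

text \<open>All that the later arguments use about the two frames: they are isometries whose range
  projections are the extreme spectral projections.\<close>

lemma eigenspace_frames:
  assumes A: "hermitian_mat n A" and q: "ordered_eigenbasis n A q"
  defines "t \<equiv> eig_mult A (eig A 0)" and "s \<equiv> eig_mult A (eig A (n - 1))"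
  defines "Q1 \<equiv> mat_of_cols n (take t q)" and "Q2 \<equiv> mat_of_cols n (drop (n - s) q)"
  shows "Q1 \<in> carrier_mat n t" "mat_adjoint Q1 * Q1 = 1\<^sub>m t"
    "Q1 * mat_adjoint Q1 = spectral_proj A (eig A 0)"
    "Q2 \<in> carrier_mat n s" "mat_adjoint Q2 * Q2 = 1\<^sub>m s"
    "Q2 * mat_adjoint Q2 = spectral_proj A (eig A (n - 1))"
proof -
  have Ac: "A \<in> carrier_mat n n" using A by (simp add: hermitian_mat_def)
  note u = ordered_eigenbasis_unitary[OF q Ac]
  have len: "length q = n" using q by (simp add: ordered_eigenbasis_def)
  have t: "t \<le> n" and s: "s \<le> n" unfolding t_def s_def
    using eig_top_indices(1)[OF A] eig_bottom_indices(1)[OF A] by auto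
  have "take t q = map ((!) q) [0..<t]" using t len by (intro nth_equalityI) auto
  then have Q1: "Q1 = mat_of_cols n (map ((!) q) [0..<t])" by (simp add: Q1_def)
  have "drop (n - s) q = map ((!) q) [n - s..<n]" using s len by (intro nth_equalityI) auto
  then have Q2: "Q2 = mat_of_cols n (map ((!) q) [n - s..<n])" by (simp add: Q2_def)
  note f1 = mat_of_cols_segment[OF u(1) len le0 t, folded Q1]
  note f2 = mat_of_cols_segment[OF u(1) len diff_le_self order_refl, of s, folded Q2]
  show "Q1 \<in> carrier_mat n t" "mat_adjoint Q1 * Q1 = 1\<^sub>m t" using f1 by auto
  show "Q2 \<in> carrier_mat n s" "mat_adjoint Q2 * Q2 = 1\<^sub>m s" using f2 s by auto
  show "Q1 * mat_adjoint Q1 = spectral_proj A (eig A 0)"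
    unfolding f1(2) spectral_proj_herm_fun(1)[OF u]
    by (rule herm_fun_cong) (simp add: eig_top_indices(2)[OF A] t_def)
  show "Q2 * mat_adjoint Q2 = spectral_proj A (eig A (n - 1))"
    unfolding f2(2) spectral_proj_herm_fun(1)[OF u]
    by (rule herm_fun_cong) (simp only: eig_bottom_indices(2)[OF A] s_def simp_thms)
qed

lemma unit_proj_carrier: "unit_proj n k \<in> carrier_mat n n"
proof -
  have "mat_of_cols n [unit_vec n k] \<in> carrier_mat n 1" by (rule carrier_matI) auto
  then show ?thesis unfolding unit_proj_def by (metis mat_adjoint_carrier mult_carrier_mat)
qed

lemma unit_proj_index:
  assumes "i < n" "j < n" "k < n"
  shows "unit_proj n k $$ (i, j) = (if i = k \<and> j = k then 1 else 0)"
  unfolding unit_proj_def using assms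
  by (subst index_mult_mat_sum[of _ n 1 _ n]) (auto simp: mat_of_cols_index unit_vec_def intro!: carrier_matI)

text \<open>Cyclicity moves R^* to the right, and E_k then selects a single diagonal entry. The
  equations in b) thus say that Q1 U Q1^* and Q2 V Q2^* have equal diagonals.\<close>

lemma mat_trace_unit_proj:
  assumes R: "R \<in> carrier_mat n t" and U: "U \<in> carrier_mat t t" and k: "k < n"
  shows "mat_trace (mat_adjoint R * unit_proj n k * R * U) = (R * U * mat_adjoint R) $$ (k, k)"
proof -
  note E = unit_proj_carrier[of n k]
  have aR: "mat_adjoint R \<in> carrier_mat t n" using R by simp
  have RU: "R * U \<in> carrier_mat n t" using R U by simp
  have M: "R * U * mat_adjoint R \<in> carrier_mat n n" using RU aR by (rule mult_carrier_mat)
  have ERU: "unit_proj n k * (R * U) \<in> carrier_mat n t" using E RU by (rule mult_carrier_mat)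
  have ER: "unit_proj n k * R \<in> carrier_mat n t" using E R by (rule mult_carrier_mat)
  have "mat_adjoint R * unit_proj n k * R * U = mat_adjoint R * (unit_proj n k * (R * U))"
    unfolding assoc_mult_mat[OF aR E R] assoc_mult_mat[OF aR ER U] assoc_mult_mat[OF E R U] ..
  also have "mat_trace \<dots> = mat_trace (unit_proj n k * (R * U) * mat_adjoint R)"
    by (rule mat_trace_comm[OF aR ERU])
  also have "\<dots> = mat_trace (unit_proj n k * (R * U * mat_adjoint R))"
    unfolding assoc_mult_mat[OF E RU aR] ..
  also have "\<dots> = (\<Sum>i<n. \<Sum>l<n. if i = k \<and> l = k then (R * U * mat_adjoint R) $$ (l, i) else 0)"
    unfolding mat_trace_mult[OF E M] using k by (intro sum.cong refl) (auto simp: unit_proj_index)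
  also have "\<dots> = (\<Sum>i<n. if i = k then (R * U * mat_adjoint R) $$ (k, i) else 0)"
    using k by (intro sum.cong refl) (auto simp: sum.delta)
  finally show ?thesis using k by (simp add: sum.delta)
qed

subsection \<open>Equivalence of the conditions\<close>

lemma feasible_iff:
  assumes "hermitian_mat n A" "1 \<le> n" "y \<in> carrier_vec n"
  shows "feasible n A w y \<longleftrightarrow> spectral_norm (with_diag A y) \<le> w"
  unfolding spectral_norm_le_iff[OF hermitian_with_diag[OF assms(1,3)] assms(2)]
  using assms(3) by (auto simp: feasible_def abs_le_iff minus_le_iff)

text \<open>For given \<open>y\<close> the least feasible \<open>w\<close> is the norm of A(y), and
  the hypothesis on \<open>x\<close> means A(x) = A.\<close>

lemma solves_min_problem_iff:
  assumes A: "hermitian_mat n A" and n: "1 \<le> n" and x: "x \<in> carrier_vec n"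
    and Ax: "map_vec complex_of_real x = diag_vec A"
  shows "solves_min_problem n A x \<longleftrightarrow>
    (\<forall>y\<in>carrier_vec n. spectral_norm A \<le> spectral_norm (with_diag A y))"
proof -
  have Ac: "A \<in> carrier_mat n n" using A by (simp add: hermitian_mat_def)
  have "complex_of_real (x $ i) = A $$ (i, i)" if "i < n" for i
    using arg_cong[OF Ax, of "\<lambda>v. v $ i"] that x Ac by (simp add: diag_vec_def)
  then have Axx: "with_diag A x = A"
    using Ac carrier_matD[OF with_diag_carrier[OF Ac x]]
    by (intro eq_matI) (auto simp: with_diag_index[OF Ac x])
  show ?thesis
  proof
    assume "solves_min_problem n A x"
    then obtain w where w: "feasible n A w x" "\<And>w' y. feasible n A w' y \<Longrightarrow> w \<le> w'"
      unfolding solves_min_problem_def by blast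
    show "\<forall>y\<in>carrier_vec n. spectral_norm A \<le> spectral_norm (with_diag A y)"
      using w feasible_iff[OF A n x, of w] feasible_iff[OF A n] Axx by (metis order_refl order_trans)
  next
    assume *: "\<forall>y\<in>carrier_vec n. spectral_norm A \<le> spectral_norm (with_diag A y)"
    have "feasible n A (spectral_norm A) x" using feasible_iff[OF A n x] Axx by simp
    moreover have "spectral_norm A \<le> w'" if "feasible n A w' y" for w' y
    proof -
      have "y \<in> carrier_vec n" using that by (simp add: feasible_def)
      with * feasible_iff[OF A n this] that show ?thesis by fastforce
    qed
    ultimately show "solves_min_problem n A x" unfolding solves_min_problem_def by blast
  qed
qed

text \<open>Weak duality for c) and d) together. \<open>X\<close> is an arbitrary square matrix, as
  c) requires; being nonzero, it has positive trace norm, which can be cancelled.\<close>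

lemma trace_norm_attained_imp_minimal:
  assumes A: "hermitian_mat n A" and n: "1 \<le> n" and X: "X \<in> carrier_mat n n"
    and X0: "X \<noteq> 0\<^sub>m n n" and diag: "diag_vec X = 0\<^sub>v n"
    and tr: "mat_trace (A * X) = complex_of_real (spectral_norm A * trace_norm X)"
    and y: "y \<in> carrier_vec n"
  shows "spectral_norm A \<le> spectral_norm (with_diag A y)"
proof -
  have Ac: "A \<in> carrier_mat n n" using A by (simp add: hermitian_mat_def)
  note M = mat_abs_props[OF X]
  have "X $$ (k, k) = 0" if "k < n" for k
    using arg_cong[OF diag, of "\<lambda>v. v $ k"] that X by (simp add: diag_vec_def)
  then have "mat_trace (with_diag A y * X) = complex_of_real (spectral_norm A * trace_norm X)"
    using mat_trace_with_diag_mult[OF Ac y X] tr by simp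
  then have "cmod (mat_trace (with_diag A y * X)) = \<bar>spectral_norm A * trace_norm X\<bar>" by (simp only: norm_of_real)
  moreover have "cmod (mat_trace (with_diag A y * X)) \<le> spectral_norm (with_diag A y) * trace_norm X"
    unfolding trace_norm_def
    by (rule cmod_trace_mult_le[OF hermitian_with_diag[OF A y] n order_refl X M])
  ultimately have le: "spectral_norm A * trace_norm X \<le> spectral_norm (with_diag A y) * trace_norm X" by linarith
  have "trace_norm X \<noteq> 0"
  proof
    assume "trace_norm X = 0"
    then have "mat_abs X = 0\<^sub>m n n" using mat_trace_psd(3)[OF M(1)] by (simp add: trace_norm_def)
    then have "mat_adjoint X * X = 0\<^sub>m n n" using M(2) by (simp add: right_mult_zero_mat[of _ n])
    then show False using adjoint_mult_self_eq_0[OF X] X0 by simp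
  qed
  moreover have "0 \<le> trace_norm X" unfolding trace_norm_def by (rule mat_trace_psd(2)[OF M(1)])
  ultimately show ?thesis using le by simp
qed

lemma certificate_imp_minimal:
  assumes A: "hermitian_mat n A" and n: "1 \<le> n" and cert: "certificate n A P N"
    and y: "y \<in> carrier_vec n"
  shows "spectral_norm A \<le> spectral_norm (with_diag A y)"
proof -
  let ?m = "spectral_norm A" and ?m' = "spectral_norm (with_diag A y)"
  have Ac: "A \<in> carrier_mat n n" using A by (simp add: hermitian_mat_def)
  have psd: "psd_mat n P" "psd_mat n N" and tr: "mat_trace P + mat_trace N = 1"
    and diag: "\<And>k. k < n \<Longrightarrow> P $$ (k, k) = N $$ (k, k)"
    and AP: "A * P = complex_of_real ?m \<cdot>\<^sub>m P" and AN: "A * N = complex_of_real (- ?m) \<cdot>\<^sub>m N"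
    using cert by (auto simp: certificate_def)
  have c: "P \<in> carrier_mat n n" "N \<in> carrier_mat n n" using psd by auto
  note By = with_diag_carrier[OF Ac y]
  \<comment> \<open>A positive semidefinite matrix is its own absolute value, so trace duality
    applies with \<open>R\<close> in both roles.\<close>
  have bound: "cmod (mat_trace (with_diag A y * R)) \<le> ?m' * Re (mat_trace R)" if "psd_mat n R" for R
    using cmod_trace_mult_le[OF hermitian_with_diag[OF A y] n order_refl psd_mat_carrier[OF that] that] that
    by (simp add: psd_mat_def hermitian_mat_def)
  have mm: "mat_trace (M * (P - N)) = mat_trace (M * P) - mat_trace (M * N)" if "M \<in> carrier_mat n n" for M
    using that c by (simp add: mult_minus_distrib_mat[of _ n n _ n] mat_trace_minus[of _ n])
  have "mat_trace (A * (P - N)) = complex_of_real ?m * (mat_trace P + mat_trace N)"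
    unfolding mm[OF Ac] AP AN using c by (simp add: mat_trace_smult[of _ n] algebra_simps)
  moreover have "mat_trace (with_diag A y * (P - N)) = mat_trace (A * (P - N))"
    using c diag by (intro mat_trace_with_diag_mult[OF Ac y]) auto
  ultimately have "complex_of_real ?m = mat_trace (with_diag A y * P) - mat_trace (with_diag A y * N)"
    by (simp add: mm[OF By] tr)
  then have "cmod (complex_of_real ?m) \<le> cmod (mat_trace (with_diag A y * P)) + cmod (mat_trace (with_diag A y * N))"
    by (simp add: norm_triangle_ineq4)
  then have "?m \<le> ?m' * Re (mat_trace P) + ?m' * Re (mat_trace N)"
    using bound[OF psd(1)] bound[OF psd(2)] by simp
  also have "\<dots> = ?m' * Re (mat_trace P + mat_trace N)" by (simp add: algebra_simps)
  finally show ?thesis unfolding tr by simp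
qed

text \<open>Equal diagonals give \<open>P\<close> and \<open>N\<close> the same trace, namely 1/2,
  so neither vanishes and both ||A|| and -||A|| are eigenvalues. This accounts for the spectral
  condition in b).\<close>

lemma certificate_extreme_eig:
  assumes A: "hermitian_mat n A" and cert: "certificate n A P N"
  shows "eig A 0 = spectral_norm A" "eig A (n - 1) = - spectral_norm A"
proof -
  have psd: "psd_mat n P" "psd_mat n N" and tr: "mat_trace P + mat_trace N = 1"
    and diag: "\<And>k. k < n \<Longrightarrow> P $$ (k, k) = N $$ (k, k)"
    and AP: "A * P = complex_of_real (spectral_norm A) \<cdot>\<^sub>m P"
    and AN: "A * N = complex_of_real (- spectral_norm A) \<cdot>\<^sub>m N"
    using cert by (auto simp: certificate_def)
  have c: "P \<in> carrier_mat n n" "N \<in> carrier_mat n n" using psd by auto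
  have "mat_trace P = mat_trace N" using c diag by (auto simp: mat_trace_def)
  then have "mat_trace P \<noteq> 0" "mat_trace N \<noteq> 0" using tr by auto
  then have "P \<noteq> 0\<^sub>m n n" "N \<noteq> 0\<^sub>m n n" by (auto simp: mat_trace_def)
  then obtain i j where "i < n" "eig A i = spectral_norm A" "j < n" "eig A j = - spectral_norm A"
    using eig_of_eigenmatrix[OF A c(1) _ AP] eig_of_eigenmatrix[OF A c(2) _ AN] by blast
  then show "eig A 0 = spectral_norm A" "eig A (n - 1) = - spectral_norm A"
    using extreme_eig_eq_spectral_norm[OF A] by blast+
qed

text \<open>The range of \<open>P\<close> lies in the eigenspace, so R R^* P = P, and taking
  adjoints gives P R R^* = P. Hence the compression loses neither \<open>P\<close> nor its
  trace.\<close>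

lemma compress_to_frame:
  assumes A: "hermitian_mat n A" and P: "psd_mat n P" and R: "R \<in> carrier_mat n t"
    and RR: "R * mat_adjoint R = spectral_proj A a"
    and AP: "A * P = complex_of_real a \<cdot>\<^sub>m P"
  defines "U \<equiv> mat_adjoint R * P * R"
  shows "psd_mat t U" "R * U * mat_adjoint R = P" "mat_trace U = mat_trace P"
proof -
  have Pc: "P \<in> carrier_mat n n" and adjP: "mat_adjoint P = P" using P by (auto simp: psd_mat_def hermitian_mat_def)
  have aR: "mat_adjoint R \<in> carrier_mat t n" using R by simp
  have EP: "R * mat_adjoint R * P = P"
    unfolding RR by (rule spectral_proj_mult_eigenmatrix[OF A Pc AP])
  have RRc: "R * mat_adjoint R \<in> carrier_mat n n" using R aR by (rule mult_carrier_mat)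
  have "mat_adjoint (R * mat_adjoint R * P) = P * (R * mat_adjoint R)"
    unfolding mat_adjoint_mult[OF RRc Pc] mat_adjoint_mult[OF R aR] adjP mat_adjoint_adjoint ..
  then have PE: "P * (R * mat_adjoint R) = P" unfolding EP adjP ..
  show "psd_mat t U" unfolding U_def by (rule psd_conj[OF P R])
  have aRP: "mat_adjoint R * P \<in> carrier_mat t n" using aR Pc by (rule mult_carrier_mat)
  have U: "U \<in> carrier_mat t t" unfolding U_def using aRP R by (rule mult_carrier_mat)
  have "R * U * mat_adjoint R = R * (mat_adjoint R * P * (R * mat_adjoint R))"
    unfolding assoc_mult_mat[OF R U aR] unfolding U_def assoc_mult_mat[OF aRP R aR] ..
  also have "\<dots> = R * (mat_adjoint R * P)"
    unfolding assoc_mult_mat[OF aR Pc RRc] PE ..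
  also have "\<dots> = P" unfolding assoc_mult_mat[OF R aR Pc, symmetric] by (rule EP)
  finally show "R * U * mat_adjoint R = P" .
  have "mat_trace U = mat_trace (R * (mat_adjoint R * P))" unfolding U_def by (rule mat_trace_comm[OF aRP R])
  then show "mat_trace U = mat_trace P" unfolding assoc_mult_mat[OF R aR Pc, symmetric] EP .
qed

text \<open>The way back: R^* R = 1 preserves the trace, and R R^* being the spectral projection
  puts the range of the expanded matrix into the eigenspace.\<close>

lemma expand_from_frame:
  assumes A: "hermitian_mat n A" and U: "psd_mat t U" and R: "R \<in> carrier_mat n t"
    and RR: "R * mat_adjoint R = spectral_proj A a" and RR1: "mat_adjoint R * R = 1\<^sub>m t"
  defines "P \<equiv> R * U * mat_adjoint R"
  shows "psd_mat n P" "mat_trace P = mat_trace U" "A * P = complex_of_real a \<cdot>\<^sub>m P"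
proof -
  have Uc: "U \<in> carrier_mat t t" using U by simp
  have Ac: "A \<in> carrier_mat n n" using A by (simp add: hermitian_mat_def)
  have aR: "mat_adjoint R \<in> carrier_mat t n" using R by simp
  show psd: "psd_mat n P" using psd_conj[OF U aR] by (simp add: P_def)
  have Pc: "P \<in> carrier_mat n n" using psd by simp
  have RU: "R * U \<in> carrier_mat n t" using R Uc by (rule mult_carrier_mat)
  have UaR: "U * mat_adjoint R \<in> carrier_mat t n" using Uc aR by (rule mult_carrier_mat)
  have P': "P = R * (U * mat_adjoint R)" unfolding P_def by (rule assoc_mult_mat[OF R Uc aR])
  have "mat_trace P = mat_trace (U * mat_adjoint R * R)" unfolding P' by (rule mat_trace_comm[OF R UaR])
  also have "U * mat_adjoint R * R = U" unfolding assoc_mult_mat[OF Uc aR R] RR1 using Uc by simp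
  finally show "mat_trace P = mat_trace U" .
  note E = eigenmatrix_spectral_proj[OF A, of a]
  have RRc: "R * mat_adjoint R \<in> carrier_mat n n" using R aR by (rule mult_carrier_mat)
  have "spectral_proj A a * P = R * (mat_adjoint R * P)"
    unfolding RR[symmetric] by (rule assoc_mult_mat[OF R aR Pc])
  also have "mat_adjoint R * P = U * mat_adjoint R"
    unfolding P' assoc_mult_mat[OF aR R UaR, symmetric] RR1 by (rule left_mult_one_mat[OF UaR])
  finally have EP: "spectral_proj A a * P = P" unfolding P' .
  have "A * P = A * spectral_proj A a * P"
    using EP assoc_mult_mat[OF Ac E(1) Pc] by simp
  also have "\<dots> = complex_of_real a \<cdot>\<^sub>m (spectral_proj A a * P)"
    unfolding E(2) by (rule mult_smult_assoc_mat[OF E(1) Pc])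
  finally show "A * P = complex_of_real a \<cdot>\<^sub>m P" unfolding EP .
qed

lemma certificate_imp_frame_multipliers:
  assumes A: "hermitian_mat n A" and cert: "certificate n A P N" and q: "ordered_eigenbasis n A q"
  defines "t \<equiv> eig_mult A (eig A 0)" and "s \<equiv> eig_mult A (eig A (n - 1))"
  defines "Q1 \<equiv> mat_of_cols n (take t q)" and "Q2 \<equiv> mat_of_cols n (drop (n - s) q)"
  shows "\<exists>U V. psd_mat t U \<and> psd_mat s V \<and> mat_trace U + mat_trace V = 1 \<and>
    (\<forall>k<n. mat_trace (mat_adjoint Q1 * unit_proj n k * Q1 * U)
      - mat_trace (mat_adjoint Q2 * unit_proj n k * Q2 * V) = 0)"
proof -
  note F = eigenspace_frames[OF A q, folded t_def s_def, folded Q1_def Q2_def]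
  note e = certificate_extreme_eig[OF A cert]
  have psd: "psd_mat n P" "psd_mat n N" and tr: "mat_trace P + mat_trace N = 1"
    and diag: "\<And>k. k < n \<Longrightarrow> P $$ (k, k) = N $$ (k, k)"
    and AP: "A * P = complex_of_real (eig A 0) \<cdot>\<^sub>m P"
    and AN: "A * N = complex_of_real (eig A (n - 1)) \<cdot>\<^sub>m N"
    using cert e by (auto simp: certificate_def)
  let ?U = "mat_adjoint Q1 * P * Q1" and ?V = "mat_adjoint Q2 * N * Q2"
  note U = compress_to_frame[OF A psd(1) F(1,3) AP] and V = compress_to_frame[OF A psd(2) F(4,6) AN]
  have "mat_trace (mat_adjoint Q1 * unit_proj n k * Q1 * ?U)
      - mat_trace (mat_adjoint Q2 * unit_proj n k * Q2 * ?V) = 0" if k: "k < n" for k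
    unfolding mat_trace_unit_proj[OF F(1) psd_mat_carrier[OF U(1)] k]
      mat_trace_unit_proj[OF F(4) psd_mat_carrier[OF V(1)] k] U(2) V(2) using diag[OF k] by simp
  then show ?thesis using U V tr by (intro exI[of _ ?U] exI[of _ ?V]) simp
qed

lemma frame_multipliers_imp_certificate:
  assumes A: "hermitian_mat n A" and q: "ordered_eigenbasis n A q"
    and e: "eig A 0 = spectral_norm A" "eig A (n - 1) = - spectral_norm A"
  defines "t \<equiv> eig_mult A (eig A 0)" and "s \<equiv> eig_mult A (eig A (n - 1))"
  defines "Q1 \<equiv> mat_of_cols n (take t q)" and "Q2 \<equiv> mat_of_cols n (drop (n - s) q)"
  assumes U: "psd_mat t U" and V: "psd_mat s V" and tr: "mat_trace U + mat_trace V = 1"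
    and diag: "\<And>k. k < n \<Longrightarrow> mat_trace (mat_adjoint Q1 * unit_proj n k * Q1 * U)
      - mat_trace (mat_adjoint Q2 * unit_proj n k * Q2 * V) = 0"
  shows "certificate n A (Q1 * U * mat_adjoint Q1) (Q2 * V * mat_adjoint Q2)"
proof -
  note F = eigenspace_frames[OF A q, folded t_def s_def, folded Q1_def Q2_def]
  note P = expand_from_frame[OF A U F(1,3,2)] and N = expand_from_frame[OF A V F(4,6,5)]
  have "(Q1 * U * mat_adjoint Q1) $$ (k, k) = (Q2 * V * mat_adjoint Q2) $$ (k, k)" if k: "k < n" for k
    using diag[OF k] mat_trace_unit_proj[OF F(1) psd_mat_carrier[OF U] k]
      mat_trace_unit_proj[OF F(4) psd_mat_carrier[OF V] k] by simp
  then show ?thesis using P N tr e by (simp add: certificate_def)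
qed

text \<open>For nonzero \<open>A\<close> the two parts of a certificate live on orthogonal eigenspaces, so they are
  the positive and the negative part of their difference.\<close>

lemma certificate_difference:
  assumes A: "hermitian_mat n A" and m: "spectral_norm A > 0" and cert: "certificate n A P N"
  defines "X \<equiv> P - N"
  shows "hermitian_mat n X" "X \<noteq> 0\<^sub>m n n" "diag_vec X = 0\<^sub>v n"
    "mat_abs X = P + N" "pos_part X = P" "neg_part X = N"
    "A * X = complex_of_real (spectral_norm A) \<cdot>\<^sub>m mat_abs X"
proof -
  let ?m = "complex_of_real (spectral_norm A)"
  have Ac: "A \<in> carrier_mat n n" and adjA: "mat_adjoint A = A" using A by (auto simp: hermitian_mat_def)
  have psd: "psd_mat n P" "psd_mat n N" and tr: "mat_trace P + mat_trace N = 1"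
    and diag: "\<And>k. k < n \<Longrightarrow> P $$ (k, k) = N $$ (k, k)"
    and AP: "A * P = ?m \<cdot>\<^sub>m P" and AN: "A * N = (- ?m) \<cdot>\<^sub>m N"
    using cert by (auto simp: certificate_def)
  have c: "P \<in> carrier_mat n n" "N \<in> carrier_mat n n" and adj: "mat_adjoint P = P" "mat_adjoint N = N"
    using psd by (auto simp: psd_mat_def hermitian_mat_def)
  have X: "X \<in> carrier_mat n n" unfolding X_def using c by (intro minus_carrier_mat)
  have adjX: "mat_adjoint X = X" unfolding X_def mat_adjoint_minus[OF c] adj ..
  show "hermitian_mat n X" using X adjX by (simp add: hermitian_mat_def)
  show "diag_vec X = 0\<^sub>v n" using c diag by (intro eq_vecI) (auto simp: diag_vec_def X_def)
  have "mat_adjoint (A * N) = N * A" using Ac c by (simp add: mat_adjoint_mult[of _ n n _ n] adj adjA)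
  moreover have "mat_adjoint ((- ?m) \<cdot>\<^sub>m N) = (- ?m) \<cdot>\<^sub>m mat_adjoint N" by (rule eq_matI) auto
  ultimately have NA: "N * A = (- ?m) \<cdot>\<^sub>m N" unfolding AN adj by simp
  \<comment> \<open>Evaluating N A P from either side gives m N P = - m N P, and m > 0 then forces N
    P = 0.\<close>
  have "?m \<cdot>\<^sub>m (N * P) = N * (A * P)" unfolding AP using c by (simp add: mult_smult_distrib[of _ n n _ n])
  also have "\<dots> = (- ?m) \<cdot>\<^sub>m (N * P)"
    using c Ac by (simp add: assoc_mult_mat[of _ n n _ n _ n, symmetric] NA mult_smult_assoc_mat[of _ n n _ n])
  finally have eq: "?m \<cdot>\<^sub>m (N * P) = (- ?m) \<cdot>\<^sub>m (N * P)" .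
  have NP: "N * P = 0\<^sub>m n n"
  proof (rule eq_matI)
    fix i j assume "i < dim_row (0\<^sub>m n n :: complex mat)" "j < dim_col (0\<^sub>m n n :: complex mat)"
    then have ij: "i < n" "j < n" by auto
    have "?m * (N * P) $$ (i, j) = - ?m * (N * P) $$ (i, j)"
      using arg_cong[OF eq, of "\<lambda>M. M $$ (i, j)"] ij c by (simp del: index_mult_mat(1))
    then have "2 * (?m * (N * P) $$ (i, j)) = 0" by (simp del: index_mult_mat(1))
    then show "(N * P) $$ (i, j) = 0\<^sub>m n n $$ (i, j)" using m ij by (simp del: index_mult_mat(1))
  qed (use c in auto)
  have PN: "P * N = 0\<^sub>m n n"
    using arg_cong[OF NP, of mat_adjoint] c by (simp add: mat_adjoint_mult[of _ n n _ n] adj) (auto intro!: eq_matI)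
  have cc: "P * P \<in> carrier_mat n n" "N * N \<in> carrier_mat n n" using c by auto
  \<comment> \<open>The cross terms vanish, so P + N and P - N have the same square; P + N, being
    positive semidefinite, is the absolute value.\<close>
  have "(P + N) * (P + N) = P * P + N * N"
  proof -
    have "(P + N) * (P + N) = (P * P + N * P) + (P * N + N * N)"
      using c by (simp add: add_mult_distrib_mat[of _ n n _ _ n] mult_add_distrib_mat[of _ n n _ n])
    then show ?thesis using cc by (simp add: NP PN)
  qed
  moreover have "mat_adjoint X * X = P * P + N * N"
  proof -
    have "X * X = (P * P - N * P) - (P * N - N * N)"
      using mult_minus_distrib_mat[OF X c] minus_mult_distrib_mat[OF c c(1)]
        minus_mult_distrib_mat[OF c c(2)] by (simp only: X_def)
    also have "\<dots> = P * P + N * N" unfolding NP PN using c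
      by (intro eq_matI) (auto simp del: index_mult_mat(1))
    finally show ?thesis unfolding adjX .
  qed
  ultimately show abs: "mat_abs X = P + N" using psd_add[OF psd] by (intro mat_abs_eqI[OF X]) auto
  \<comment> \<open>|X| = P + N has trace 1, whereas the absolute value of zero has trace 0.\<close>
  show "X \<noteq> 0\<^sub>m n n"
  proof
    assume X0: "X = 0\<^sub>m n n"
    have "psd_mat n (0\<^sub>m n n)" using psd_herm_fun[of n "1\<^sub>m n" "\<lambda>_. 0"] herm_fun_zero[of n "1\<^sub>m n" "\<lambda>_. 0"]
      by (simp add: unitary_mat_def)
    then have "mat_abs X = 0\<^sub>m n n" using adjX unfolding X0 by (intro mat_abs_eqI[of _ n]) auto
    then have "mat_trace (P + N) = 0" unfolding abs by (simp add: mat_trace_def)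
    then show False using tr mat_trace_add[OF c] by simp
  qed
  show "pos_part X = P" unfolding pos_part_def abs unfolding X_def using c by (intro eq_matI) auto
  show "neg_part X = N" unfolding neg_part_def abs unfolding X_def using c by (intro eq_matI) auto
  show "A * X = ?m \<cdot>\<^sub>m mat_abs X"
    unfolding abs unfolding X_def mult_minus_distrib_mat[OF Ac c] AP AN using c
    by (intro eq_matI) (auto simp: algebra_simps)
qed

lemma mat_trace_of_eigen_relation:
  assumes X: "X \<in> carrier_mat n n" and AX: "A * X = complex_of_real a \<cdot>\<^sub>m mat_abs X"
  shows "mat_trace (A * X) = complex_of_real (a * trace_norm X)"
  unfolding AX using mat_trace_psd(1)[OF mat_abs_props(1)[OF X]] mat_abs_props(1)[OF X]
  by (simp add: mat_trace_smult[of _ n] trace_norm_def)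

text \<open>Provides \<open>X\<close> in the case A = 0; the off-diagonal positions needed exist
  from size 2 on.\<close>

lemma zero_diag_hermitian_exists:
  assumes "2 \<le> n"
  shows "\<exists>X. hermitian_mat n X \<and> X \<noteq> 0\<^sub>m n n \<and> diag_vec X = 0\<^sub>v n"
proof -
  let ?X = "mat n n (\<lambda>(i, j). if i = 0 \<and> j = 1 \<or> i = 1 \<and> j = 0 then 1 else 0 :: complex)"
  have "?X $$ (0, 1) \<noteq> 0\<^sub>m n n $$ (0, 1)" using assms by simp
  then have "?X \<noteq> 0\<^sub>m n n" by metis
  moreover have "hermitian_mat n ?X" unfolding hermitian_mat_def by (auto intro!: eq_matI)
  moreover have "diag_vec ?X = 0\<^sub>v n" by (auto simp: diag_vec_def)
  ultimately show ?thesis by blast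
qed

text \<open>One Hermitian matrix serves both c) and d): the trace identity of d) follows from the
  matrix equation by taking traces. At A = 0 a certificate may have P = N, but then both spectral
  projections are the identity and the equation reads 0 = 0, so the zero diagonal and nonvanishing
  are the only demands on \<open>X\<close>.\<close>

lemma minimal_imp_dual_matrix:
  assumes A: "hermitian_mat n A" and n: "1 \<le> n" and nz: "n = 1 \<Longrightarrow> A \<noteq> 0\<^sub>m n n"
    and minimal: "\<forall>y\<in>carrier_vec n. spectral_norm A \<le> spectral_norm (with_diag A y)"
  shows "\<exists>X. hermitian_mat n X \<and> X \<noteq> 0\<^sub>m n n \<and> diag_vec X = 0\<^sub>v n \<and>
    spectral_proj A (eig A 0) * pos_part X = pos_part X \<and>
    spectral_proj A (eig A (n - 1)) * neg_part X = neg_part X \<and>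
    A * X = complex_of_real (spectral_norm A) \<cdot>\<^sub>m mat_abs X"
proof (cases "spectral_norm A = 0")
  case True
  have A0: "A = 0\<^sub>m n n" by (rule spectral_norm_eq_0[OF A True])
  then have "2 \<le> n" using n nz by (cases "n = 1") auto
  from zero_diag_hermitian_exists[OF this] obtain X where X: "hermitian_mat n X" "X \<noteq> 0\<^sub>m n n" "diag_vec X = 0\<^sub>v n"
    by blast
  have Xc: "X \<in> carrier_mat n n" using X(1) by (simp add: hermitian_mat_def)
  have aX: "mat_abs X \<in> carrier_mat n n" using mat_abs_props(1)[OF Xc] by simp
  have pc: "pos_part X \<in> carrier_mat n n" "neg_part X \<in> carrier_mat n n"
    using Xc aX by (auto simp: pos_part_def neg_part_def intro!: minus_carrier_mat)
  have z: "A * Z = complex_of_real 0 \<cdot>\<^sub>m Z" if "Z \<in> carrier_mat n n" for Z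
    using that unfolding A0 by (intro eq_matI) (auto simp: left_mult_zero_mat[of _ _ n])
  have e: "eig A i = 0" if "i < n" for i using abs_eig_le_spectral_norm[OF A that] True by simp
  have "A * X = complex_of_real 0 \<cdot>\<^sub>m mat_abs X"
    unfolding z[OF Xc] using Xc aX by (intro eq_matI) auto
  then show ?thesis
    using X True e[of 0] e[of "n - 1"] n spectral_proj_mult_eigenmatrix[OF A pc(1) z[OF pc(1)]]
      spectral_proj_mult_eigenmatrix[OF A pc(2) z[OF pc(2)]] by auto
next
  case False
  then have m: "0 < spectral_norm A" using spectral_norm_nonneg[OF A n] by simp
  obtain P N where cert: "certificate n A P N" using minimal_imp_certificate[OF A n minimal] by blast
  note D = certificate_difference[OF A m cert] and e = certificate_extreme_eig[OF A cert]
  have P: "P \<in> carrier_mat n n" "A * P = complex_of_real (spectral_norm A) \<cdot>\<^sub>m P"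
    and N: "N \<in> carrier_mat n n" "A * N = complex_of_real (- spectral_norm A) \<cdot>\<^sub>m N"
    using cert by (auto simp: certificate_def)
  show ?thesis
    using D spectral_proj_mult_eigenmatrix[OF A P] spectral_proj_mult_eigenmatrix[OF A N] e
    by (intro exI[of _ "P - N"]) simp
qed

text \<open>One certificate yields multipliers for every eigenbasis, while multipliers for a single
  eigenbasis give a certificate back. Existence of an eigenbasis keeps the quantifier over
  \<open>q\<close> from being vacuous.\<close>

lemma minimal_iff_frame_multipliers:
  assumes A: "hermitian_mat n A" and n: "1 \<le> n"
  shows "(\<forall>y\<in>carrier_vec n. spectral_norm A \<le> spectral_norm (with_diag A y)) \<longleftrightarrow>
    eig A 0 = spectral_norm A \<and> eig A (n - 1) = - spectral_norm A \<and>
    (\<forall>q. ordered_eigenbasis n A q \<longrightarrow>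
      (let t = eig_mult A (eig A 0); s = eig_mult A (eig A (n - 1));
           Q1 = mat_of_cols n (take t q); Q2 = mat_of_cols n (drop (n - s) q)
       in \<exists>U V. psd_mat t U \<and> psd_mat s V \<and> mat_trace U + mat_trace V = 1 \<and>
            (\<forall>k<n. mat_trace (mat_adjoint Q1 * unit_proj n k * Q1 * U)
                   - mat_trace (mat_adjoint Q2 * unit_proj n k * Q2 * V) = 0)))"
    (is "?min \<longleftrightarrow> ?b")
proof
  assume ?min
  from minimal_imp_certificate[OF A n this] obtain P N where cert: "certificate n A P N" by blast
  show ?b using certificate_extreme_eig[OF A cert] certificate_imp_frame_multipliers[OF A cert]
    unfolding Let_def by blast
next
  assume b: ?b
  obtain q where q: "ordered_eigenbasis n A q" using ordered_eigenbasis_exists[OF A] by blast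
  have e: "eig A 0 = spectral_norm A" "eig A (n - 1) = - spectral_norm A" using b by blast+
  from b q have "\<exists>P N. certificate n A P N"
    unfolding Let_def using frame_multipliers_imp_certificate[OF A q e] by blast
  then show ?min using certificate_imp_minimal[OF A n] by blast
qed

lemma minimal_iff_dual_matrix:
  assumes A: "hermitian_mat n A" and n: "1 \<le> n" and nz: "n = 1 \<Longrightarrow> A \<noteq> 0\<^sub>m n n"
  shows "(\<forall>y\<in>carrier_vec n. spectral_norm A \<le> spectral_norm (with_diag A y)) \<longleftrightarrow>
    (\<exists>X\<in>carrier_mat n n. X \<noteq> 0\<^sub>m n n \<and> diag_vec X = 0\<^sub>v n \<and>
      A * X = complex_of_real (spectral_norm A) \<cdot>\<^sub>m mat_abs X)"
  using minimal_imp_dual_matrix[OF A n nz] trace_norm_attained_imp_minimal[OF A n]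
    mat_trace_of_eigen_relation
  unfolding hermitian_mat_def by metis

lemma minimal_iff_hermitian_dual_matrix:
  assumes A: "hermitian_mat n A" and n: "1 \<le> n" and nz: "n = 1 \<Longrightarrow> A \<noteq> 0\<^sub>m n n"
  shows "(\<forall>y\<in>carrier_vec n. spectral_norm A \<le> spectral_norm (with_diag A y)) \<longleftrightarrow>
    (\<exists>X. hermitian_mat n X \<and> X \<noteq> 0\<^sub>m n n \<and> diag_vec X = 0\<^sub>v n \<and>
      spectral_proj A (eig A 0) * pos_part X = pos_part X \<and>
      spectral_proj A (eig A (n - 1)) * neg_part X = neg_part X \<and>
      mat_trace (A * X) = complex_of_real (spectral_norm A * trace_norm X))"
  using minimal_imp_dual_matrix[OF A n nz] trace_norm_attained_imp_minimal[OF A n]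
    mat_trace_of_eigen_relation
  unfolding hermitian_mat_def by metis

theorem theorem2:
  fixes n :: nat and A :: "complex mat" and x :: "real vec"
  assumes "n \<ge> 1"
    and "hermitian_mat n A"
    and "n = 1 \<Longrightarrow> A \<noteq> 0\<^sub>m n n"
    and "x \<in> carrier_vec n"
    and "map_vec complex_of_real x = diag_vec A"
  shows
    "(solves_min_problem n A x \<longleftrightarrow>
       (\<forall>y\<in>carrier_vec n. spectral_norm A \<le> spectral_norm (with_diag A y))) \<and>
     (solves_min_problem n A x \<longleftrightarrow>
       eig A 0 = spectral_norm A \<and> eig A (n - 1) = - spectral_norm A \<and>
       (\<forall>q. ordered_eigenbasis n A q \<longrightarrow>
         (let t = eig_mult A (eig A 0); s = eig_mult A (eig A (n - 1));
              Q1 = mat_of_cols n (take t q); Q2 = mat_of_cols n (drop (n - s) q)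
          in \<exists>U V. psd_mat t U \<and> psd_mat s V \<and> mat_trace U + mat_trace V = 1 \<and>
               (\<forall>k<n. mat_trace (mat_adjoint Q1 * unit_proj n k * Q1 * U)
                      - mat_trace (mat_adjoint Q2 * unit_proj n k * Q2 * V) = 0)))) \<and>
     (solves_min_problem n A x \<longleftrightarrow>
       (\<exists>X\<in>carrier_mat n n. X \<noteq> 0\<^sub>m n n \<and> diag_vec X = 0\<^sub>v n \<and>
          A * X = complex_of_real (spectral_norm A) \<cdot>\<^sub>m mat_abs X)) \<and>
     (solves_min_problem n A x \<longleftrightarrow>
       (\<exists>X. hermitian_mat n X \<and> X \<noteq> 0\<^sub>m n n \<and> diag_vec X = 0\<^sub>v n \<and>
          spectral_proj A (eig A 0) * pos_part X = pos_part X \<and>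
          spectral_proj A (eig A (n - 1)) * neg_part X = neg_part X \<and>
          mat_trace (A * X) = complex_of_real (spectral_norm A * trace_norm X)))"
  unfolding solves_min_problem_iff[OF assms(2,1,4,5)]
  by (intro conjI refl minimal_iff_frame_multipliers[OF assms(2,1)]
      minimal_iff_dual_matrix[OF assms(2,1,3)] minimal_iff_hermitian_dual_matrix[OF assms(2,1,3)])


end
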